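(* Let $k\ge 1$, let $G:\mathbb{R}\to\mathbb{R}$ be a smooth ($C^\infty$) function, let $g=G'$, and consider the Euclidean Hamiltonian system on $\mathbb{R}^{2k}$ with Hamiltonian $H(q,r)=G\bigl((|q|^2+|r|^2)/2\bigr)$, that is, the initial value problem $$u'(t)=f(u(t)),\quad u(0)=u_0,\quad u=\begin{pmatrix} q\\ r\end{pmatrix},\quad f(q,r)=g\bigl((|q|^2+|r|^2)/2\bigr)\begin{pmatrix} r\\ -q\end{pmatrix},\qquad q,r\in\mathbb{R}^k .$$ Let $(a_{ij})_{i,j=1}^s$, $(b_i)_{i=1}^s$ be the real coefficients of a (possibly implicit) Runge--Kutta method with $s$ stages and of order $p$. If $p$ is odd, then the corresponding relaxation Runge--Kutta scheme conserving the Hamiltonian has order of accuracy $p+1$ for this system.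
   Context: Runge--Kutta method: for step size $\Delta t>0$ and current value $u^n$, the stages solve $y_i=u^n+\Delta t\sum_{j=1}^s a_{ij}f(y_j)$, $i=1,\dots,s$ (for implicit methods and small $\Delta t$, the solution close to $u^n$ is meant), and the baseline update is $u^{n+1}=u^n+\Delta t\, d^n$ with $d^n=\sum_{i=1}^s b_i f(y_i)$. The method has order $p$ if, for every smooth autonomous ODE $u'=f(u)$, one step from $u_0$ satisfies $u^1-u(\Delta t)=O(\Delta t^{p+1})$ as $\Delta t\to 0$, where $u$ is the exact solution with $u(0)=u_0$. Relaxation Runge--Kutta (RRK) scheme: the update is replaced by $u^{n+1}_\gamma=u^n+\gamma^n\Delta t\, d^n$, which is interpreted as an approximation of $u(t_n+\gamma^n\Delta t)$. The relaxation parameter $\gamma^n\in\mathbb{R}$ is chosen so that the Hamiltonian is conserved, $H(u^{n+1}_\gamma)=H(u^n)$. For a Euclidean Hamiltonian system this is achieved by conserving the Euclidean norm: $\gamma^n$ is the nonzero solution of $\|u^n+\gamma^n\Delta t\,d^n\|^2=\|u^n\|^2$ (with $\gamma^n=1$ if $d^n=0$). Such a nonzero solution is assumed to exist for all sufficiently small $\Delta t$. The RRK scheme has order of accuracy $m$ for the system if, for every initial value $u_0$, one step from $u_0$ satisfies $u^1_\gamma-u(\gamma^0\Delta t)=O(\Delta t^{m+1})$ as $\Delta t\to0$, where $u$ is the exact solution with $u(0)=u_0$. *)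

theory Defs
  imports "HOL-Analysis.Analysis" "HOL-Analysis.Finite_Function_Topology" "HOL-Library.Landau_Symbols"
begin

text \<open>
  The order of a Runge--Kutta method refers to smooth autonomous ODEs of every dimension \<open>n\<close>. Since
  \<open>n\<close> is quantified inside that definition, \<open>\<real>\<^sup>n\<close> is represented there by the \<open>n\<close>-dimensional subspace
  of finitely supported sequences vanishing from index \<open>n\<close> on. The library equips this type with
  the \<open>\<ell>\<^sup>1\<close>-norm, which on each such subspace is equivalent to the Euclidean norm. The solution
  and stage predicates take the state space \<open>X\<close> as a parameter; they are used both for these
  subspaces and, with \<open>X = UNIV\<close>, for the Hamiltonian system.
\<close>

definition Rn :: "nat \<Rightarrow> (nat \<Rightarrow>\<^sub>0 real) set"
  where "Rn n = {x. Poly_Mapping.keys x \<subseteq> {..<n}}"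

text \<open>\<open>Ck_Rn n k F\<close>: on \<open>\<real>\<^sup>n\<close>, all partial derivatives of \<open>F\<close> of order at most \<open>k\<close> exist and are
  continuous.\<close>

primrec Ck_Rn :: "nat \<Rightarrow> nat \<Rightarrow> ((nat \<Rightarrow>\<^sub>0 real) \<Rightarrow> 'b::real_normed_vector) \<Rightarrow> bool"
  where
    "Ck_Rn n 0 F \<longleftrightarrow> continuous_on (Rn n) F"
  | "Ck_Rn n (Suc k) F \<longleftrightarrow> continuous_on (Rn n) F \<and>
       (\<forall>i<n. \<exists>F'. Ck_Rn n k F' \<and>
          (\<forall>x\<in>Rn n. ((\<lambda>t. F (x + Poly_Mapping.single i t)) has_vector_derivative F' x) (at 0)))"

definition smooth_field_Rn :: "nat \<Rightarrow> ((nat \<Rightarrow>\<^sub>0 real) \<Rightarrow> (nat \<Rightarrow>\<^sub>0 real)) \<Rightarrow> bool"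
  where "smooth_field_Rn n F \<longleftrightarrow> F ` Rn n \<subseteq> Rn n \<and> (\<forall>k. Ck_Rn n k F)"

definition smooth_real :: "(real \<Rightarrow> real) \<Rightarrow> bool"
  where "smooth_real G \<longleftrightarrow> (\<forall>m x. (deriv ^^ m) G differentiable (at x))"

text \<open>The interval is two-sided, since the relaxation parameter and hence the time
  \<open>\<gamma> \<Delta>t\<close> may be negative.\<close>

definition ode_solution ::
    "'a::real_normed_vector set \<Rightarrow> ('a \<Rightarrow> 'a) \<Rightarrow> 'a \<Rightarrow> real \<Rightarrow> (real \<Rightarrow> 'a) \<Rightarrow> bool"
  where "ode_solution X f u0 T u \<longleftrightarrow> T > 0 \<and> u 0 = u0 \<and>
     (\<forall>t\<in>{-T<..<T}. u t \<in> X \<and> (u has_vector_derivative f (u t)) (at t))"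

definition rk_stages ::
    "'a::real_normed_vector set \<Rightarrow> nat \<Rightarrow> (nat \<Rightarrow> nat \<Rightarrow> real) \<Rightarrow> ('a \<Rightarrow> 'a) \<Rightarrow> 'a \<Rightarrow> real \<Rightarrow>
      (nat \<Rightarrow> 'a) \<Rightarrow> bool"
  where "rk_stages X s a f u0 h y \<longleftrightarrow>
     (\<forall>i\<in>{1..s}. y i \<in> X \<and> y i = u0 + h *\<^sub>R (\<Sum>j=1..s. a i j *\<^sub>R f (y j)))"

text \<open>The stage equations of an implicit method may have several solutions. The one close to
  \<open>u0\<close> is selected by requiring that the stages \<open>Y h\<close> for step size \<open>h\<close> tend to \<open>u0\<close> as
  \<open>h \<rightarrow> 0\<close>; for smooth \<open>f\<close> this determines them for all sufficiently small \<open>h > 0\<close>.\<close>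

definition rk_stage_family ::
    "'a::real_normed_vector set \<Rightarrow> nat \<Rightarrow> (nat \<Rightarrow> nat \<Rightarrow> real) \<Rightarrow> ('a \<Rightarrow> 'a) \<Rightarrow> 'a \<Rightarrow>
      (real \<Rightarrow> nat \<Rightarrow> 'a) \<Rightarrow> bool"
  where "rk_stage_family X s a f u0 Y \<longleftrightarrow>
     (\<forall>\<^sub>F h in at_right 0. rk_stages X s a f u0 h (Y h)) \<and>
     (\<forall>i\<in>{1..s}. ((\<lambda>h. Y h i) \<longlongrightarrow> u0) (at_right 0))"

definition rk_direction ::
    "nat \<Rightarrow> (nat \<Rightarrow> real) \<Rightarrow> ('a::real_normed_vector \<Rightarrow> 'a) \<Rightarrow> (nat \<Rightarrow> 'a) \<Rightarrow> 'a"
  where "rk_direction s b f y = (\<Sum>i=1..s. b i *\<^sub>R f (y i))"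

definition rk_has_order ::
    "nat \<Rightarrow> (nat \<Rightarrow> nat \<Rightarrow> real) \<Rightarrow> (nat \<Rightarrow> real) \<Rightarrow> nat \<Rightarrow> bool"
  where "rk_has_order s a b p \<longleftrightarrow>
     (\<forall>n F u0 Y T u.
        smooth_field_Rn n F \<longrightarrow> u0 \<in> Rn n \<longrightarrow>
        rk_stage_family (Rn n) s a F u0 Y \<longrightarrow> ode_solution (Rn n) F u0 T u \<longrightarrow>
        (\<lambda>h. norm (u0 + h *\<^sub>R rk_direction s b F (Y h) - u h)) \<in> O[at_right 0](\<lambda>h. h ^ (p + 1)))"

definition is_relaxation :: "'a::real_inner \<Rightarrow> real \<Rightarrow> 'a \<Rightarrow> real \<Rightarrow> bool"
  where "is_relaxation u0 h d \<gamma> \<longleftrightarrow>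
     (if d = 0 then \<gamma> = 1
      else \<gamma> \<noteq> 0 \<and> (norm (u0 + (\<gamma> * h) *\<^sub>R d))\<^sup>2 = (norm u0)\<^sup>2)"

definition relaxation_param :: "'a::real_inner \<Rightarrow> real \<Rightarrow> 'a \<Rightarrow> real"
  where "relaxation_param u0 h d = (THE \<gamma>. is_relaxation u0 h d \<gamma>)"

lemma is_relaxation_unique:
  assumes "h \<noteq> 0" "is_relaxation u0 h d \<gamma>" "is_relaxation u0 h d \<gamma>'"
  shows "\<gamma> = \<gamma>'"
proof (cases "d = 0")
  case True
  then show ?thesis using assms by (simp add: is_relaxation_def)
next
  case False
  have key: "x * (h * (d \<bullet> d)) = - 2 * (u0 \<bullet> d)" if "is_relaxation u0 h d x" for x
  proof -
    have x: "x \<noteq> 0" and "(norm (u0 + (x * h) *\<^sub>R d))\<^sup>2 = (norm u0)\<^sup>2"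
      using that False by (auto simp: is_relaxation_def)
    then have "2 * ((x * h) * (u0 \<bullet> d)) + (x * h) * ((x * h) * (d \<bullet> d)) = 0"
      by (simp add: power2_norm_eq_inner inner_add_left inner_add_right inner_commute mult_ac)
    then have "(x * h) * (2 * (u0 \<bullet> d) + x * (h * (d \<bullet> d))) = 0"
      by (simp add: algebra_simps)
    with x assms(1) show ?thesis by simp
  qed
  have "\<gamma> * (h * (d \<bullet> d)) = \<gamma>' * (h * (d \<bullet> d))"
    using key[OF assms(2)] key[OF assms(3)] by simp
  then show ?thesis using False assms(1) by simp
qed

lemma is_relaxation_relaxation_param:
  assumes "h \<noteq> 0" "\<exists>\<gamma>. is_relaxation u0 h d \<gamma>"
  shows "is_relaxation u0 h d (relaxation_param u0 h d)"
  unfolding relaxation_param_def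
  using assms is_relaxation_unique[OF assms(1)] by (blast intro: theI)

definition rrk_has_order ::
    "nat \<Rightarrow> (nat \<Rightarrow> nat \<Rightarrow> real) \<Rightarrow> (nat \<Rightarrow> real) \<Rightarrow> ('a::real_inner \<Rightarrow> 'a) \<Rightarrow> nat \<Rightarrow> bool"
  where "rrk_has_order s a b f m \<longleftrightarrow>
     (\<forall>u0 Y T u.
        rk_stage_family UNIV s a f u0 Y \<longrightarrow> ode_solution UNIV f u0 T u \<longrightarrow>
        (\<lambda>h. let d = rk_direction s b f (Y h); \<gamma> = relaxation_param u0 h d
             in norm (u0 + (\<gamma> * h) *\<^sub>R d - u (\<gamma> * h))) \<in> O[at_right 0](\<lambda>h. h ^ (m + 1)))"

definition euclidean_hamiltonian ::
    "(real \<Rightarrow> real) \<Rightarrow> 'a::real_inner \<times> 'a \<Rightarrow> real"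
  where "euclidean_hamiltonian G = (\<lambda>(q, r). G (((norm q)\<^sup>2 + (norm r)\<^sup>2) / 2))"

definition euclidean_hamiltonian_field ::
    "(real \<Rightarrow> real) \<Rightarrow> 'a::real_inner \<times> 'a \<Rightarrow> 'a \<times> 'a"
  where "euclidean_hamiltonian_field G =
     (\<lambda>(q, r). deriv G (((norm q)\<^sup>2 + (norm r)\<^sup>2) / 2) *\<^sub>R (r, - q))"

lemma euclidean_hamiltonian_norm:
  "euclidean_hamiltonian G u = G ((norm u)\<^sup>2 / 2)"
  by (cases u) (simp add: euclidean_hamiltonian_def norm_Pair)

text \<open>In particular, the norm-preserving relaxation parameter conserves the Hamiltonian.\<close>

lemma euclidean_hamiltonian_conserved:
  assumes "h \<noteq> 0" "d \<noteq> 0" "\<exists>\<gamma>. is_relaxation u0 h d \<gamma>"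
  shows "euclidean_hamiltonian G (u0 + (relaxation_param u0 h d * h) *\<^sub>R d) =
         euclidean_hamiltonian G u0"
  using is_relaxation_relaxation_param[OF assms(1,3)] assms(2)
  by (simp add: is_relaxation_def euclidean_hamiltonian_norm)

end

theory Submission
  imports Defs "HOL-Computational_Algebra.Polynomial"
begin

text \<open>
  Let \<open>J (q, r) = (r, - q)\<close>. The field is \<open>f u = g (\<bar>u\<bar>\<^sup>2 / 2) J u\<close>, and \<open>J\<close> squares to \<open>- 1\<close>, so \<open>u0\<close>
  and \<open>J u0\<close> span a copy of the complex plane in which \<open>J\<close> is multiplication by \<open>\<i>\<close> and
  \<open>u0\<close> is \<open>1\<close>. The field preserves this plane, and there it reads
  \<open>z \<mapsto> \<i> \<kappa>(\<bar>z\<bar>\<^sup>2) z\<close> with a smooth real function \<open>\<kappa>\<close>. The exact solution is the uniform rotation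
  \<open>cis (\<omega> t)\<close> with \<open>\<omega> = \<kappa> 1\<close> (\<open>hamiltonian_solution_rotation\<close>), and for small step sizes \<open>h\<close> the
  stages lie in the plane as well (\<open>hamiltonian_stages_in_plane\<close>). The whole problem becomes
  two-dimensional.

  The role of odd \<open>p\<close> is a parity. Complex conjugation reverses the rotation, so replacing \<open>h\<close>
  by \<open>- h\<close> conjugates the baseline step \<open>R h = 1 + h d h\<close>: its real part is even in \<open>h\<close> and its
  imaginary part is odd (\<open>Im_direction_even_expansion\<close>). The error \<open>R h - cis (\<omega> h)\<close> has the same
  parity, and it is \<open>O(h\<^sup>p\<^sup>+\<^sup>1)\<close> with \<open>p + 1\<close> even. An odd function cannot start with an even power,
  so its imaginary part is \<open>O(h\<^sup>p\<^sup>+\<^sup>2)\<close>: to leading order, the method errs in the radius and not in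
  the phase.

  Relaxation repairs the radius, by moving the numerical solution along \<open>d\<close> back to the unit circle.
  Since \<open>d = \<i> \<omega> + O(h)\<close> is tangential to leading order and the time is changed from
  \<open>h\<close> to \<open>\<gamma> h\<close> along with the step, this leaves the phase error at \<open>O(h\<^sup>p\<^sup>+\<^sup>2)\<close>;
  and between two points of the circle the distance is controlled by the difference of the phases (\<open>relaxed_error_on_circle\<close>).

  This argument divides by \<open>\<omega>\<close>. If \<open>f u0 = 0\<close>, that is \<open>u0 = 0\<close> or \<open>\<omega> = 0\<close>, then for small \<open>h\<close> all stages
  equal \<open>u0\<close>, and the scheme reproduces the constant solution exactly
  (\<open>relaxed_step_exact_at_equilibrium\<close>).
\<close>


section \<open>Functions of small positive step sizes\<close>

lemma bigo_1_if_tendsto: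
  fixes f :: "'a \<Rightarrow> real"
  assumes "(f \<longlongrightarrow> c) F"
  shows "f \<in> O[F](\<lambda>_. 1)"
proof -
  have "\<forall>\<^sub>F x in F. dist (f x) c < 1"
    using assms by (rule tendstoD) simp
  then have "\<forall>\<^sub>F x in F. norm (f x) \<le> (\<bar>c\<bar> + 1) * norm (1::real)"
    by eventually_elim (auto simp: dist_real_def)
  then show ?thesis by (rule bigoI)
qed

lemma bigo_power_mono:
  assumes "m \<le> n"
  shows "(\<lambda>h::real. h ^ n) \<in> O[at_right 0](\<lambda>h. h ^ m)"
proof (rule bigoI[of _ 1])
  have "\<forall>\<^sub>F h::real in at_right 0. h < 1" "\<forall>\<^sub>F h::real in at_right 0. h > 0"
    by (auto simp: eventually_at_right[of 0 1] eventually_at_right_less intro!: exI[of _ 1])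
  then show "\<forall>\<^sub>F h::real in at_right 0. norm (h ^ n) \<le> 1 * norm (h ^ m)"
    by eventually_elim (use assms in \<open>auto simp: power_decreasing\<close>)
qed

lemma bigo_weaken_power:
  fixes f :: "real \<Rightarrow> real"
  assumes "f \<in> O[at_right 0](\<lambda>h. h ^ n)" "m \<le> n"
  shows "f \<in> O[at_right 0](\<lambda>h. h ^ m)"
  using assms(1) bigo_power_mono[OF assms(2)] by (rule landau_o.big_trans)

lemma bigo_mult_power:
  fixes f g :: "real \<Rightarrow> real"
  assumes "f \<in> O[at_right 0](\<lambda>h. h ^ m)" "g \<in> O[at_right 0](\<lambda>h. h ^ n)"
  shows "(\<lambda>h. f h * g h) \<in> O[at_right 0](\<lambda>h. h ^ (m + n))"
  using landau_o.big_mult[OF assms] by (simp add: power_add)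

lemma tendsto_0_if_bigo_power:
  fixes f :: "real \<Rightarrow> real"
  assumes "f \<in> O[at_right 0](\<lambda>h. h ^ n)" "n > 0"
  shows "(f \<longlongrightarrow> 0) (at_right 0)"
proof -
  have "((\<lambda>h::real. h ^ n) \<longlongrightarrow> 0 ^ n) (at_right 0)"
    by (intro tendsto_intros)
  then have "((\<lambda>h::real. h ^ n) \<longlongrightarrow> 0) (at_right 0)"
    using assms(2) by simp
  then have "(\<lambda>h::real. h ^ n) \<in> o[at_right 0](\<lambda>_. 1)"
    by (intro smalloI_tendsto) auto
  with assms(1) have "f \<in> o[at_right 0](\<lambda>_. 1)"
    by (rule landau_o.big_small_trans)
  then show ?thesis using smalloD_tendsto[of f "at_right 0" "\<lambda>_. 1"] by simp
qed


section \<open>Smooth functions of one real variable\<close>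

lemma smooth_real_DERIV:
  "smooth_real \<kappa> \<Longrightarrow> ((deriv ^^ m) \<kappa> has_real_derivative (deriv ^^ Suc m) \<kappa> x) (at x)"
  by (simp add: smooth_real_def DERIV_deriv_iff_real_differentiable)

lemma smooth_real_isCont: "smooth_real \<kappa> \<Longrightarrow> isCont ((deriv ^^ m) \<kappa>) x"
  by (simp add: smooth_real_def differentiable_imp_continuous_within)

lemma smooth_real_deriv: "smooth_real \<kappa> \<Longrightarrow> smooth_real (deriv \<kappa>)"
  unfolding smooth_real_def by (metis comp_apply funpow_Suc_right)

lemma smooth_real_scale:
  assumes "smooth_real \<kappa>"
  shows "smooth_real (\<lambda>x. \<kappa> (c * x))"
proof -
  have eq: "(deriv ^^ m) (\<lambda>x. \<kappa> (c * x)) = (\<lambda>x. c ^ m * (deriv ^^ m) \<kappa> (c * x))" for m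
  proof (induction m)
    case (Suc m)
    have "((\<lambda>x. c ^ m * (deriv ^^ m) \<kappa> (c * x)) has_real_derivative
        c ^ Suc m * (deriv ^^ Suc m) \<kappa> (c * x)) (at x)" for x
      by (auto intro!: derivative_eq_intros DERIV_chain2[OF smooth_real_DERIV[OF assms]]
          simp del: funpow.simps)
    then show ?case by (simp add: Suc fun_eq_iff DERIV_imp_deriv)
  qed simp
  have "((\<lambda>x. c ^ m * (deriv ^^ m) \<kappa> (c * x)) has_real_derivative
        c ^ Suc m * (deriv ^^ Suc m) \<kappa> (c * x)) (at x)" for x m
      by (auto intro!: derivative_eq_intros DERIV_chain2[OF smooth_real_DERIV[OF assms]]
          simp del: funpow.simps)
  then show ?thesis
    unfolding smooth_real_def eq using real_differentiable_def by blast
qed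


section \<open>Expansions in even powers of the step size\<close>

text \<open>
  The expansion is truncated and one-sided, because the stages are only given as some family for
  small \<open>h > 0\<close>. Evenness cannot be read off there as invariance under \<open>h \<mapsto> - h\<close>; it is recorded as
  approximation by polynomials in \<open>h\<^sup>2\<close>.
\<close>

definition even_expansion :: "nat \<Rightarrow> (real \<Rightarrow> real) \<Rightarrow> bool"
  where "even_expansion k \<phi> \<longleftrightarrow>
    (\<exists>P. (\<lambda>h. \<phi> h - poly P (h\<^sup>2)) \<in> O[at_right 0](\<lambda>h. h ^ (2 * k)))"

lemma poly_square_tendsto: "((\<lambda>h::real. poly P (h\<^sup>2)) \<longlongrightarrow> poly P 0) (at_right 0)"
proof -
  have "((\<lambda>h::real. poly P (h\<^sup>2)) \<longlongrightarrow> poly P (0\<^sup>2)) (at_right 0)"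
    by (intro tendsto_intros)
  then show ?thesis by simp
qed

lemma even_expansion_cong:
  assumes "\<forall>\<^sub>F h in at_right 0. \<phi> h = \<psi> h"
  shows "even_expansion k \<phi> \<longleftrightarrow> even_expansion k \<psi>"
  unfolding even_expansion_def
  by (intro ex_cong1 landau_o.big.in_cong) (use assms in \<open>auto elim: eventually_mono\<close>)

lemma even_expansion_0_iff: "even_expansion 0 \<phi> \<longleftrightarrow> \<phi> \<in> O[at_right 0](\<lambda>_. 1)"
proof
  assume "even_expansion 0 \<phi>"
  then obtain P where P: "(\<lambda>h. \<phi> h - poly P (h\<^sup>2)) \<in> O[at_right 0](\<lambda>_. 1)"
    by (auto simp: even_expansion_def)
  from sum_in_bigo(1)[OF P bigo_1_if_tendsto[OF poly_square_tendsto[of P]]]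
  show "\<phi> \<in> O[at_right 0](\<lambda>_. 1)" by simp
next
  assume "\<phi> \<in> O[at_right 0](\<lambda>_. 1)"
  then show "even_expansion 0 \<phi>"
    unfolding even_expansion_def by (intro exI[of _ 0]) simp
qed

lemma even_expansion_mono:
  assumes "even_expansion k \<phi>" "l \<le> k"
  shows "even_expansion l \<phi>"
  using assms bigo_weaken_power[of _ "2 * k" "2 * l"] by (auto simp: even_expansion_def)

lemma even_expansion_bounded:
  "even_expansion k \<phi> \<Longrightarrow> \<phi> \<in> O[at_right 0](\<lambda>_. 1)"
  using even_expansion_mono[of k \<phi> 0] by (simp add: even_expansion_0_iff)

lemma even_expansion_poly: "even_expansion k (\<lambda>h. poly P (h\<^sup>2))"
  unfolding even_expansion_def by (intro exI[of _ P]) simp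

lemma even_expansion_const: "even_expansion k (\<lambda>_. c)"
  using even_expansion_poly[of k "[:c:]"] by simp

lemma even_expansion_add:
  assumes "even_expansion k \<phi>" "even_expansion k \<psi>"
  shows "even_expansion k (\<lambda>h. \<phi> h + \<psi> h)"
proof -
  obtain P Q where "(\<lambda>h. \<phi> h - poly P (h\<^sup>2)) \<in> O[at_right 0](\<lambda>h. h ^ (2 * k))"
    "(\<lambda>h. \<psi> h - poly Q (h\<^sup>2)) \<in> O[at_right 0](\<lambda>h. h ^ (2 * k))"
    using assms by (auto simp: even_expansion_def)
  from sum_in_bigo(1)[OF this] show ?thesis
    unfolding even_expansion_def by (intro exI[of _ "P + Q"]) (simp add: algebra_simps)
qed

lemma even_expansion_mult:
  assumes "even_expansion k \<phi>" "even_expansion k \<psi>"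
  shows "even_expansion k (\<lambda>h. \<phi> h * \<psi> h)"
proof -
  obtain P Q where P: "(\<lambda>h. \<phi> h - poly P (h\<^sup>2)) \<in> O[at_right 0](\<lambda>h. h ^ (2 * k))"
    and Q: "(\<lambda>h. \<psi> h - poly Q (h\<^sup>2)) \<in> O[at_right 0](\<lambda>h. h ^ (2 * k))"
    using assms by (auto simp: even_expansion_def)
  have "(\<lambda>h. (\<phi> h - poly P (h\<^sup>2)) * \<psi> h + (\<psi> h - poly Q (h\<^sup>2)) * poly P (h\<^sup>2))
      \<in> O[at_right 0](\<lambda>h. h ^ (2 * k))"
    using landau_o.big_mult[OF P even_expansion_bounded[OF assms(2)]]
      landau_o.big_mult[OF Q bigo_1_if_tendsto[OF poly_square_tendsto[of P]]]
    by (intro sum_in_bigo) simp_all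
  then show ?thesis
    unfolding even_expansion_def by (intro exI[of _ "P * Q"]) (simp add: algebra_simps)
qed

lemma even_expansion_sum:
  "(\<And>i. i \<in> I \<Longrightarrow> even_expansion k (\<phi> i)) \<Longrightarrow> even_expansion k (\<lambda>h. \<Sum>i\<in>I. \<phi> i h)"
  by (induction I rule: infinite_finite_induct)
    (auto intro: even_expansion_add even_expansion_const)

lemma even_expansion_power:
  "even_expansion k \<phi> \<Longrightarrow> even_expansion k (\<lambda>h. \<phi> h ^ n)"
  by (induction n) (auto intro: even_expansion_mult even_expansion_const)

text \<open>
  The extra factor \<open>h\<^sup>2\<close> buys one more term of the expansion; this gain drives the induction in
  \<open>Im_direction_even_expansion\<close>.
\<close>

lemma even_expansion_square_times:
  assumes "even_expansion k \<phi>"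
  shows "even_expansion (Suc k) (\<lambda>h. h\<^sup>2 * \<phi> h)"
proof -
  obtain P where "(\<lambda>h. \<phi> h - poly P (h\<^sup>2)) \<in> O[at_right 0](\<lambda>h. h ^ (2 * k))"
    using assms by (auto simp: even_expansion_def)
  then have "(\<lambda>h. h\<^sup>2 * (\<phi> h - poly P (h\<^sup>2))) \<in> O[at_right 0](\<lambda>h. h ^ (2 + 2 * k))"
    by (intro bigo_mult_power) auto
  then show ?thesis
    unfolding even_expansion_def
    by (intro exI[of _ "[:0, 1:] * P"]) (simp add: algebra_simps)
qed

text \<open>
  Taylor's formula at \<open>c\<close>: since \<open>\<phi> - c\<close> is of size \<open>h\<^sup>2\<close>, the first \<open>k\<close> Taylor terms are even
  expansions again and the remainder is of size \<open>h\<^sup>2\<^sup>k\<close>.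
\<close>

lemma even_expansion_compose:
  assumes "smooth_real \<kappa>" "even_expansion k \<phi>"
    and near: "(\<lambda>h. \<phi> h - c) \<in> O[at_right 0](\<lambda>h. h ^ 2)"
  shows "even_expansion k (\<lambda>h. \<kappa> (\<phi> h))"
proof -
  define T where "T x = (\<Sum>m<k. (deriv ^^ m) \<kappa> c / fact m * x ^ m)" for x
  have "continuous_on {c - 1..c + 1} ((deriv ^^ k) \<kappa>)"
    by (intro continuous_at_imp_continuous_on) (simp add: smooth_real_isCont[OF assms(1)])
  then have "bounded ((deriv ^^ k) \<kappa> ` {c - 1..c + 1})"
    by (intro compact_imp_bounded compact_continuous_image) auto
  then obtain B where B: "\<And>y. y \<in> {c - 1..c + 1} \<Longrightarrow> \<bar>(deriv ^^ k) \<kappa> y\<bar> \<le> B"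
    by (force simp: bounded_iff)
  have taylor: "\<bar>\<kappa> (c + x) - T x\<bar> \<le> B * \<bar>x ^ k\<bar>" if "\<bar>x\<bar> < 1" for x
  proof -
    have d: "((\<lambda>x. (deriv ^^ m) \<kappa> (c + x)) has_real_derivative (deriv ^^ Suc m) \<kappa> (c + t)) (at t)"
      for m t
      using smooth_real_DERIV[OF assms(1), where m = m and x = "t + c"]
        DERIV_shift[of "(deriv ^^ m) \<kappa>" _ t c]
      by (simp add: add.commute del: funpow.simps)
    obtain t where t: "\<bar>t\<bar> \<le> \<bar>x\<bar>"
      "\<kappa> (c + x) = (\<Sum>m<k. (deriv ^^ m) \<kappa> (c + 0) / fact m * x ^ m) + (deriv ^^ k) \<kappa> (c + t) / fact k * x ^ k"
      using Maclaurin_bi_le[of "\<lambda>m x. (deriv ^^ m) \<kappa> (c + x)" "\<lambda>x. \<kappa> (c + x)" k x] d by auto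
    have "\<bar>(deriv ^^ k) \<kappa> (c + t) / fact k\<bar> \<le> \<bar>(deriv ^^ k) \<kappa> (c + t)\<bar>"
      by (simp add: divide_le_eq mult_le_cancel_left1 fact_ge_1)
    also have "\<dots> \<le> B" using t(1) that by (intro B) auto
    finally have "\<bar>(deriv ^^ k) \<kappa> (c + t) / fact k\<bar> * \<bar>x ^ k\<bar> \<le> B * \<bar>x ^ k\<bar>"
      by (rule mult_right_mono) simp
    moreover have "\<kappa> (c + x) - T x = (deriv ^^ k) \<kappa> (c + t) / fact k * x ^ k"
      using t(2) by (simp add: T_def)
    ultimately show ?thesis by (simp only: abs_mult)
  qed
  have "even_expansion k (\<lambda>h. \<phi> h + - c)"
    by (intro even_expansion_add assms even_expansion_const)
  then have "even_expansion k (\<lambda>h. T (\<phi> h + - c))"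
    unfolding T_def
    by (intro even_expansion_sum even_expansion_mult even_expansion_const even_expansion_power)
  then obtain P where P: "(\<lambda>h. T (\<phi> h - c) - poly P (h\<^sup>2)) \<in> O[at_right 0](\<lambda>h. h ^ (2 * k))"
    by (auto simp: even_expansion_def)
  have "\<forall>\<^sub>F h in at_right 0. \<bar>\<phi> h - c\<bar> < 1"
    using tendstoD[OF tendsto_0_if_bigo_power[OF near], of 1] by (simp add: dist_real_def)
  then have "\<forall>\<^sub>F h in at_right 0. norm (\<kappa> (\<phi> h) - T (\<phi> h - c)) \<le> B * norm ((\<phi> h - c) ^ k)"
    by eventually_elim (use taylor in fastforce)
  then have "(\<lambda>h. \<kappa> (\<phi> h) - T (\<phi> h - c)) \<in> O[at_right 0](\<lambda>h. (\<phi> h - c) ^ k)"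
    by (rule bigoI)
  moreover have "(\<lambda>h. (\<phi> h - c) ^ k) \<in> O[at_right 0](\<lambda>h. h ^ (2 * k))"
    using landau_o.big_power[OF near, of k] by (simp add: power_mult)
  ultimately have "(\<lambda>h. \<kappa> (\<phi> h) - T (\<phi> h - c)) \<in> O[at_right 0](\<lambda>h. h ^ (2 * k))"
    by (rule landau_o.big_trans)
  from sum_in_bigo(1)[OF this P] show ?thesis
    unfolding even_expansion_def by (intro exI[of _ P]) simp
qed

text \<open>
  A polynomial in \<open>h\<^sup>2\<close> that tends to zero has no constant term, so \<open>h\<^sup>2\<close> can be split off
  repeatedly.
\<close>

lemma poly_square_bigo_odd_imp_even:
  assumes "(\<lambda>h. poly P (h\<^sup>2)) \<in> O[at_right 0](\<lambda>h::real. h ^ (2 * m + 1))"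
  shows "(\<lambda>h. poly P (h\<^sup>2)) \<in> O[at_right 0](\<lambda>h::real. h ^ (2 * m + 2))"
  using assms
proof (induction m arbitrary: P)
  case (0 P)
  have "poly P 0 = 0"
    using tendsto_unique[OF _ poly_square_tendsto tendsto_0_if_bigo_power[OF 0]] by simp
  then obtain Q where Q: "P = [:0, 1:] * Q"
    by (auto simp: poly_eq_0_iff_dvd elim: dvdE)
  have "(\<lambda>h. h\<^sup>2 * poly Q (h\<^sup>2)) \<in> O[at_right 0](\<lambda>h::real. h ^ (2 + 0))"
    by (intro bigo_mult_power) (auto intro: bigo_1_if_tendsto[OF poly_square_tendsto])
  then show ?case by (simp add: Q numeral_2_eq_2)
next
  case (Suc m P)
  have "poly P 0 = 0"
    using tendsto_unique[OF _ poly_square_tendsto tendsto_0_if_bigo_power[OF Suc.prems]] by simp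
  then obtain Q where Q: "P = [:0, 1:] * Q"
    by (auto simp: poly_eq_0_iff_dvd elim: dvdE)
  have nz: "\<forall>\<^sub>F h in at_right (0::real). h\<^sup>2 \<noteq> 0"
    using eventually_at_right_less[of "0::real"] by eventually_elim simp
  have "(\<lambda>h. h\<^sup>2 * poly Q (h\<^sup>2)) \<in> O[at_right 0](\<lambda>h::real. h\<^sup>2 * h ^ (2 * m + 1))"
    using Suc.prems by (simp add: Q power2_eq_square mult_ac)
  then have "(\<lambda>h. poly Q (h\<^sup>2)) \<in> O[at_right 0](\<lambda>h::real. h ^ (2 * m + 1))"
    using landau_o.big.mult_cancel_left[OF bigtheta_refl nz] by blast
  then have "(\<lambda>h. poly Q (h\<^sup>2)) \<in> O[at_right 0](\<lambda>h::real. h ^ (2 * m + 2))"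
    by (rule Suc.IH)
  then have "(\<lambda>h. h\<^sup>2 * poly Q (h\<^sup>2)) \<in> O[at_right 0](\<lambda>h::real. h ^ (2 + (2 * m + 2)))"
    by (intro bigo_mult_power) auto
  then show ?case by (simp add: Q)
qed

text \<open>
  This is the source of the additional order: the first term that survives in an expansion of
  size \<open>O(h\<^sup>2\<^sup>m\<^sup>+\<^sup>1)\<close> has an even exponent.
\<close>

lemma even_expansion_bigo_odd_imp_even:
  assumes "even_expansion (m + 1) \<phi>" "\<phi> \<in> O[at_right 0](\<lambda>h. h ^ (2 * m + 1))"
  shows "\<phi> \<in> O[at_right 0](\<lambda>h. h ^ (2 * m + 2))"
proof -
  obtain P where P: "(\<lambda>h. \<phi> h - poly P (h\<^sup>2)) \<in> O[at_right 0](\<lambda>h. h ^ (2 * m + 2))"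
    using assms(1) by (auto simp: even_expansion_def)
  then have "(\<lambda>h. \<phi> h - poly P (h\<^sup>2)) \<in> O[at_right 0](\<lambda>h. h ^ (2 * m + 1))"
    by (rule bigo_weaken_power) simp
  from sum_in_bigo(2)[OF assms(2) this]
  have "(\<lambda>h. poly P (h\<^sup>2)) \<in> O[at_right 0](\<lambda>h. h ^ (2 * m + 1))" by simp
  from sum_in_bigo(1)[OF P poly_square_bigo_odd_imp_even[OF this]] show ?thesis by simp
qed

text \<open>
  With \<open>\<omega> = \<kappa> 1\<close>, this is the contribution of the exact solution to the phase error.
\<close>

lemma even_expansion_sin_div:
  "even_expansion k (\<lambda>h. sin (\<omega> * h) / h)"
proof -
  define P :: "real poly" where "P = (\<Sum>j<k. monom (sin_coeff (2 * j + 1) * \<omega> ^ (2 * j + 1)) j)"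
  have odd_part: "(\<Sum>m<2 * k + 1. sin_coeff m * (\<omega> * h) ^ m) = h * poly P (h\<^sup>2)" for h
  proof (unfold P_def, induction k)
    case (Suc k)
    have "(\<Sum>m<2 * Suc k + 1. sin_coeff m * (\<omega> * h) ^ m) =
        (\<Sum>m<2 * k + 1. sin_coeff m * (\<omega> * h) ^ m)
        + sin_coeff (2 * k + 1) * (\<omega> * h) ^ (2 * k + 1)"
      by (simp add: sin_coeff_def)
    also have "\<dots> = h * poly (\<Sum>j<Suc k. monom (sin_coeff (2 * j + 1) * \<omega> ^ (2 * j + 1)) j) (h\<^sup>2)"
      unfolding Suc
      by (simp add: poly_sum poly_monom algebra_simps power_mult_distrib flip: power_mult)
    finally show ?case .
  qed (simp add: sin_coeff_def)
  have "(\<lambda>h. sin (\<omega> * h) / h - poly P (h\<^sup>2)) \<in> O[at_right 0](\<lambda>h. h ^ (2 * k))"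
  proof (rule bigoI)
    show "\<forall>\<^sub>F h in at_right 0. norm (sin (\<omega> * h) / h - poly P (h\<^sup>2))
        \<le> (inverse (fact (2 * k + 1)) * \<bar>\<omega>\<bar> ^ (2 * k + 1)) * norm (h ^ (2 * k))"
      using eventually_at_right_less[of "0::real"]
    proof eventually_elim
      case (elim h)
      have "\<bar>h * (sin (\<omega> * h) / h - poly P (h\<^sup>2))\<bar> = \<bar>sin (\<omega> * h) - h * poly P (h\<^sup>2)\<bar>"
        using elim by (simp add: right_diff_distrib)
      also have "\<dots> \<le> inverse (fact (2 * k + 1)) * \<bar>\<omega> * h\<bar> ^ (2 * k + 1)"
        using Maclaurin_sin_bound[of "\<omega> * h" "2 * k + 1"] by (simp only: odd_part)
      also have "\<dots> = h * ((inverse (fact (2 * k + 1)) * \<bar>\<omega>\<bar> ^ (2 * k + 1)) * norm (h ^ (2 * k)))"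
        using elim by (simp add: abs_mult power_mult_distrib power_abs)
      finally show ?case
        using elim by (simp add: abs_mult)
    qed
  qed
  then show ?thesis by (auto simp: even_expansion_def)
qed


section \<open>Parity of the stages of a rotation field\<close>

text \<open>
  The restriction of the Hamiltonian field to an invariant plane, in complex notation. The circle
  through \<open>1\<close> is traversed with angular velocity \<open>\<kappa> 1\<close>.
\<close>

definition rotation_field :: "(real \<Rightarrow> real) \<Rightarrow> complex \<Rightarrow> complex"
  where "rotation_field \<kappa> z = of_real (\<kappa> ((cmod z)\<^sup>2)) * (\<i> * z)"

lemma Re_rotation_field: "Re (rotation_field \<kappa> z) = - \<kappa> ((cmod z)\<^sup>2) * Im z"
  and Im_rotation_field: "Im (rotation_field \<kappa> z) = \<kappa> ((cmod z)\<^sup>2) * Re z"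
  by (simp_all add: rotation_field_def)

text \<open>
  Write the stages as \<open>x\<^sub>i + \<i> h w\<^sub>i\<close>. In terms of \<open>x\<close> and \<open>w\<close>, the stage equations contain \<open>h\<close> only
  through \<open>h\<^sup>2\<close>:
  \<open>x\<^sub>i = 1 - h\<^sup>2 \<Sum>\<^sub>j a\<^sub>i\<^sub>j g\<^sub>j w\<^sub>j\<close> and \<open>w\<^sub>i = \<Sum>\<^sub>j a\<^sub>i\<^sub>j g\<^sub>j x\<^sub>j\<close> with \<open>g\<^sub>j = \<kappa> (x\<^sub>j\<^sup>2 + h\<^sup>2 w\<^sub>j\<^sup>2)\<close>.
  Inserting truncated even expansions on the right yields longer ones on the left, so an induction
  on the length gives expansions of every length without an implicit function theorem. The imaginary
  part of the direction is \<open>\<Sum>\<^sub>i b\<^sub>i g\<^sub>i x\<^sub>i\<close>.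
\<close>

lemma Im_direction_even_expansion:
  assumes \<kappa>: "smooth_real \<kappa>"
    and Z: "rk_stage_family UNIV s a (rotation_field \<kappa>) 1 Z"
  shows "even_expansion k (\<lambda>h. Im (rk_direction s b (rotation_field \<kappa>) (Z h)))"
proof -
  define x where "x i h = Re (Z h i)" for i h
  define w where "w i h = Im (Z h i) / h" for i h
  define g where "g i h = \<kappa> ((x i h)\<^sup>2 + h\<^sup>2 * (w i h)\<^sup>2)" for i h
  have stages: "\<forall>\<^sub>F h in at_right 0. h > 0 \<and> rk_stages UNIV s a (rotation_field \<kappa>) 1 h (Z h)"
    using Z eventually_at_right_less[of "0::real"]
    by (auto simp: rk_stage_family_def eventually_conj_iff)
  have cmod_Z: "(cmod (Z h i))\<^sup>2 = (x i h)\<^sup>2 + h\<^sup>2 * (w i h)\<^sup>2" if "h > 0" for h i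
    using that by (simp add: cmod_power2 x_def w_def power_divide)
  have g_eq: "g i h = \<kappa> ((cmod (Z h i))\<^sup>2)" if "h > 0" for h i
    by (simp add: g_def cmod_Z[OF that])
  have x_eq: "\<forall>\<^sub>F h in at_right 0. x i h = 1 + h\<^sup>2 * (\<Sum>j=1..s. - a i j * (g j h * w j h))"
    if "i \<in> {1..s}" for i
    using stages
  proof eventually_elim
    case (elim h)
    then have "Z h i = 1 + h *\<^sub>R (\<Sum>j=1..s. a i j *\<^sub>R rotation_field \<kappa> (Z h j))"
      using that by (auto simp: rk_stages_def)
    then have "x i h = 1 + h * (\<Sum>j=1..s. - a i j * (g j h * Im (Z h j)))"
      using elim by (simp add: x_def g_eq Re_rotation_field sum_negf)
    also have "(\<Sum>j=1..s. - a i j * (g j h * Im (Z h j))) = h * (\<Sum>j=1..s. - a i j * (g j h * w j h))"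
      using elim by (simp add: w_def sum_distrib_left)
    finally show ?case by (simp add: power2_eq_square)
  qed
  have w_eq: "\<forall>\<^sub>F h in at_right 0. w i h = (\<Sum>j=1..s. a i j * (g j h * x j h))"
    if "i \<in> {1..s}" for i
    using stages
  proof eventually_elim
    case (elim h)
    then have "Z h i = 1 + h *\<^sub>R (\<Sum>j=1..s. a i j *\<^sub>R rotation_field \<kappa> (Z h j))"
      using that by (auto simp: rk_stages_def)
    then have "Im (Z h i) = h * (\<Sum>j=1..s. a i j * (g j h * x j h))"
      using elim by (simp add: x_def g_eq Im_rotation_field)
    with elim show ?case by (simp add: w_def)
  qed
  have x_lim: "(x i \<longlongrightarrow> 1) (at_right 0)" if "i \<in> {1..s}" for i
    using that Z tendsto_Re unfolding x_def rk_stage_family_def by fastforce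
  have g_lim: "(g i \<longlongrightarrow> \<kappa> 1) (at_right 0)" if "i \<in> {1..s}" for i
  proof -
    have "((\<lambda>h. (cmod (Z h i))\<^sup>2) \<longlongrightarrow> (cmod 1)\<^sup>2) (at_right 0)"
      using that Z by (intro tendsto_intros) (auto simp: rk_stage_family_def)
    then have "((\<lambda>h. \<kappa> ((cmod (Z h i))\<^sup>2)) \<longlongrightarrow> \<kappa> 1) (at_right 0)"
      using isCont_tendsto_compose[OF smooth_real_isCont[OF \<kappa>, where m = 0]] by (simp del: norm_power)
    then show ?thesis
      by (rule Lim_transform_eventually)
        (use stages in eventually_elim, simp add: g_eq)
  qed
  have w_bounded: "w i \<in> O[at_right 0](\<lambda>_. 1)" if "i \<in> {1..s}" for i
  proof (rule bigo_1_if_tendsto)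
    have "((\<lambda>h. \<Sum>j=1..s. a i j * (g j h * x j h)) \<longlongrightarrow> (\<Sum>j=1..s. a i j * (\<kappa> 1 * 1))) (at_right 0)"
      by (intro tendsto_intros g_lim x_lim)
    then show "(w i \<longlongrightarrow> (\<Sum>j=1..s. a i j * (\<kappa> 1 * 1))) (at_right 0)"
      by (rule Lim_transform_eventually) (use w_eq[OF that] in eventually_elim, simp)
  qed
  \<comment> \<open>The boundedness of \<open>w\<close> and the equation for \<open>x\<close> turn the convergence of the stages
    into a rate, which the composition with \<open>\<kappa>\<close> requires.\<close>
  have square_near: "(\<lambda>h. (x i h)\<^sup>2 + h\<^sup>2 * (w i h)\<^sup>2 - 1) \<in> O[at_right 0](\<lambda>h. h\<^sup>2)"
    if "i \<in> {1..s}" for i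
  proof -
    have "(\<lambda>h. h\<^sup>2 * (\<Sum>j=1..s. - a i j * (g j h * w j h))) \<in> O[at_right 0](\<lambda>h. h ^ (2 + 0))"
    proof (intro bigo_mult_power)
      have "(\<lambda>h. \<Sum>j=1..s. - a i j * (g j h * w j h)) \<in> O[at_right 0](\<lambda>_. 1)"
      proof (rule big_sum_in_bigo)
        fix j assume "j \<in> {1..s}"
        from landau_o.big_mult[OF bigo_1_if_tendsto[OF g_lim[OF this]] w_bounded[OF this]]
        show "(\<lambda>h. - a i j * (g j h * w j h)) \<in> O[at_right 0](\<lambda>_. 1)" by simp
      qed
      then show "(\<lambda>h. \<Sum>j=1..s. - a i j * (g j h * w j h)) \<in> O[at_right 0](\<lambda>h. h ^ 0)" by simp
    qed auto
    moreover have "(\<lambda>h. x i h - 1) \<in> O[at_right 0](\<lambda>h. h\<^sup>2) \<longleftrightarrow>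
        (\<lambda>h. h\<^sup>2 * (\<Sum>j=1..s. - a i j * (g j h * w j h))) \<in> O[at_right 0](\<lambda>h. h\<^sup>2)"
      by (rule landau_o.big.in_cong) (use x_eq[OF that] in eventually_elim, simp)
    ultimately have "(\<lambda>h. x i h - 1) \<in> O[at_right 0](\<lambda>h. h\<^sup>2)" by simp
    moreover have "(\<lambda>h. x i h + 1) \<in> O[at_right 0](\<lambda>_. 1)"
      by (intro sum_in_bigo(1) bigo_const bigo_1_if_tendsto[OF x_lim[OF that]])
    ultimately have "(\<lambda>h. (x i h - 1) * (x i h + 1)) \<in> O[at_right 0](\<lambda>h. h\<^sup>2 * 1)"
      by (rule landau_o.big_mult)
    then have "(\<lambda>h. (x i h - 1) * (x i h + 1)) \<in> O[at_right 0](\<lambda>h. h\<^sup>2)" by simp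
    moreover have "(\<lambda>h. h\<^sup>2 * (w i h)\<^sup>2) \<in> O[at_right 0](\<lambda>h. h\<^sup>2)"
      using landau_o.big_mult[OF landau_o.big_refl[of "\<lambda>h. h\<^sup>2"]
          landau_o.big_power[OF w_bounded[OF that], of 2]]
      by simp
    ultimately have "(\<lambda>h. (x i h - 1) * (x i h + 1) + h\<^sup>2 * (w i h)\<^sup>2) \<in> O[at_right 0](\<lambda>h. h\<^sup>2)"
      by (rule sum_in_bigo)
    then show ?thesis by (simp add: algebra_simps power2_eq_square)
  qed
  have g_even: "even_expansion (Suc k) (g i)"
    if "i \<in> {1..s}" "even_expansion (Suc k) (x i)" "even_expansion k (w i)" for i k
    unfolding g_def
    by (rule even_expansion_compose[OF \<kappa> _ square_near[OF that(1)]])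
      (intro even_expansion_add even_expansion_power
        even_expansion_square_times that)
  \<comment> \<open>The real parts are one term ahead, because \<open>w\<close> enters the equation for \<open>x\<close> with a factor \<open>h\<^sup>2\<close>.\<close>
  have main: "\<forall>i\<in>{1..s}. even_expansion (Suc k) (x i) \<and> even_expansion k (w i)" for k
  proof (induction k)
    case 0
    have "even_expansion 0 (w i)" if "i \<in> {1..s}" for i
      using w_bounded[OF that] by (simp add: even_expansion_0_iff)
    moreover have "even_expansion (Suc 0) (x i)" if "i \<in> {1..s}" for i
    proof (rule even_expansion_cong[OF x_eq[OF that], THEN iffD2], intro even_expansion_add even_expansion_const
        even_expansion_square_times even_expansion_sum even_expansion_mult)
      fix j assume "j \<in> {1..s}"
      then show "even_expansion 0 (w j)" "even_expansion 0 (g j)"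
        using w_bounded bigo_1_if_tendsto[OF g_lim] by (auto simp: even_expansion_0_iff)
    qed
    ultimately show ?case by blast
  next
    case (Suc k)
    have w: "even_expansion (Suc k) (w i)" if "i \<in> {1..s}" for i
      by (rule even_expansion_cong[OF w_eq[OF that], THEN iffD2],
          intro even_expansion_sum even_expansion_mult even_expansion_const g_even)
        (use Suc in auto)
    have "even_expansion (Suc (Suc k)) (x i)" if "i \<in> {1..s}" for i
      by (rule even_expansion_cong[OF x_eq[OF that], THEN iffD2],
          intro even_expansion_add even_expansion_square_times even_expansion_sum
            even_expansion_mult even_expansion_const g_even w)
        (use Suc in auto)
    with w show ?case by blast
  qed
  have sum: "even_expansion k (\<lambda>h. \<Sum>i=1..s. b i * (g i h * x i h))"
    using main[of k]
    by (intro even_expansion_sum even_expansion_mult even_expansion_const)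
      (auto intro!: even_expansion_mono[OF g_even, of _ k] intro: even_expansion_mono[of "Suc k"])
  have "\<forall>\<^sub>F h in at_right 0. Im (rk_direction s b (rotation_field \<kappa>) (Z h)) =
      (\<Sum>i=1..s. b i * (g i h * x i h))"
    using stages
    by eventually_elim
      (simp add: rk_direction_def Im_rotation_field g_eq x_def)
  then show ?thesis
    by (rule even_expansion_cong[THEN iffD2, OF _ sum])
qed


section \<open>The order condition for a rotation field\<close>

lemma lookup_scaleR: "Poly_Mapping.lookup (r *\<^sub>R x) i = r *\<^sub>R Poly_Mapping.lookup x i"
  by (simp add: scaleR_poly_mapping_def)

lemma norm_lookup_le: "norm (Poly_Mapping.lookup x i) \<le> norm x"
proof (cases "i \<in> Poly_Mapping.keys x")
  case True
  then show ?thesis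
    unfolding norm_poly_mapping_def dist_poly_mapping_def by (auto intro: member_le_sum)
qed (simp add: in_keys_iff)

lemma bounded_linear_lookup: "bounded_linear (\<lambda>x. Poly_Mapping.lookup x i)"
  by (rule bounded_linear_intro[of _ 1]) (auto simp: lookup_add lookup_scaleR norm_lookup_le)

lemma bounded_linear_single: "bounded_linear (Poly_Mapping.single i)"
proof (rule bounded_linear_intro[of _ 1])
  fix r and x :: 'a
  show "Poly_Mapping.single i (r *\<^sub>R x) = r *\<^sub>R Poly_Mapping.single i x"
    by (rule poly_mapping_eqI) (simp add: lookup_scaleR lookup_single when_def)
  show "norm (Poly_Mapping.single i x) \<le> norm x * 1"
    by (simp add: norm_poly_mapping_def dist_poly_mapping_def)
qed (simp add: single_add)

lemma Ck_Rn_Suc_imp: "Ck_Rn n (Suc k) F \<Longrightarrow> Ck_Rn n k F"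
proof (induction k arbitrary: F)
  case (Suc k)
  then show ?case by (subst Ck_Rn.simps) (force simp del: Ck_Rn.simps simp: Ck_Rn.simps(2)[of n "Suc k"])
qed simp

lemma Ck_Rn_const: "Ck_Rn n k (\<lambda>_. c)"
proof (induction k arbitrary: c)
  case (Suc k)
  have "((\<lambda>t. c) has_vector_derivative 0) (at 0)" by simp
  with Suc[of 0] show ?case by (auto intro!: exI[of _ "\<lambda>_. 0"])
qed simp

lemma Ck_Rn_lookup: "Ck_Rn n k (\<lambda>x. Poly_Mapping.lookup x j)"
proof (cases k)
  case 0
  then show ?thesis by (simp add: bounded_linear.continuous_on[OF bounded_linear_lookup])
next
  case (Suc l)
  have "((\<lambda>t. Poly_Mapping.lookup (x + Poly_Mapping.single i t) j) has_vector_derivative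
      (if i = j then 1 else 0)) (at 0)" for x i
    by (cases "i = j")
      (auto simp: lookup_add lookup_single intro!: derivative_eq_intros)
  then show ?thesis
    unfolding Suc
    by (auto simp: bounded_linear.continuous_on[OF bounded_linear_lookup]
        intro!: exI[of _ "\<lambda>_. if _ = j then 1 else 0"] Ck_Rn_const)
qed

lemma Ck_Rn_bounded_linear:
  assumes "bounded_linear L" "Ck_Rn n k F"
  shows "Ck_Rn n k (\<lambda>x. L (F x))"
  using assms(2)
proof (induction k arbitrary: F)
  case 0
  then show ?case by (simp add: bounded_linear.continuous_on[OF assms(1)])
next
  case (Suc k)
  show ?case unfolding Ck_Rn.simps
  proof (intro conjI allI impI)
    show "continuous_on (Rn n) (\<lambda>x. L (F x))"
      using Suc.prems by (simp add: bounded_linear.continuous_on[OF assms(1)])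
    fix i assume "i < n"
    with Suc.prems obtain F' where F': "Ck_Rn n k F'"
      "\<And>x. x \<in> Rn n \<Longrightarrow> ((\<lambda>t. F (x + Poly_Mapping.single i t)) has_vector_derivative F' x) (at 0)"
      by auto
    show "\<exists>F'. Ck_Rn n k F' \<and> (\<forall>x\<in>Rn n.
        ((\<lambda>t. L (F (x + Poly_Mapping.single i t))) has_vector_derivative F' x) (at 0))"
      using Suc.IH[OF F'(1)] F'(2) bounded_linear.has_vector_derivative[OF assms(1)] by blast
  qed
qed

lemma Ck_Rn_add:
  assumes "Ck_Rn n k F" "Ck_Rn n k H"
  shows "Ck_Rn n k (\<lambda>x. F x + H x)"
  using assms
proof (induction k arbitrary: F H)
  case 0
  then show ?case by (simp add: continuous_on_add)
next
  case (Suc k)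
  show ?case unfolding Ck_Rn.simps
  proof (intro conjI allI impI)
    show "continuous_on (Rn n) (\<lambda>x. F x + H x)"
      using Suc.prems by (simp add: continuous_on_add)
    fix i assume i: "i < n"
    with Suc.prems(1) obtain F' where F': "Ck_Rn n k F'"
      "\<And>x. x \<in> Rn n \<Longrightarrow> ((\<lambda>t. F (x + Poly_Mapping.single i t)) has_vector_derivative F' x) (at 0)"
      by auto
    from i Suc.prems(2) obtain H' where H': "Ck_Rn n k H'"
      "\<And>x. x \<in> Rn n \<Longrightarrow> ((\<lambda>t. H (x + Poly_Mapping.single i t)) has_vector_derivative H' x) (at 0)"
      by auto
    show "\<exists>F'. Ck_Rn n k F' \<and> (\<forall>x\<in>Rn n. ((\<lambda>t. F (x + Poly_Mapping.single i t)
        + H (x + Poly_Mapping.single i t)) has_vector_derivative F' x) (at 0))"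
      using Suc.IH[OF F'(1) H'(1)] F'(2) H'(2) has_vector_derivative_add by blast
  qed
qed

text \<open>
  The product rule involves the factors themselves next to their derivatives, so the induction
  needs them with one derivative less, which \<open>Ck_Rn_Suc_imp\<close> provides.
\<close>

lemma Ck_Rn_mult:
  fixes F H :: "(nat \<Rightarrow>\<^sub>0 real) \<Rightarrow> real"
  assumes "Ck_Rn n k F" "Ck_Rn n k H"
  shows "Ck_Rn n k (\<lambda>x. F x * H x)"
  using assms
proof (induction k arbitrary: F H)
  case 0
  then show ?case by (simp add: continuous_on_mult)
next
  case (Suc k)
  show ?case unfolding Ck_Rn.simps
  proof (intro conjI allI impI)
    show "continuous_on (Rn n) (\<lambda>x. F x * H x)"
      using Suc.prems by (simp add: continuous_on_mult)
    fix i assume i: "i < n"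
    with Suc.prems(1) obtain F' where F': "Ck_Rn n k F'"
      "\<And>x. x \<in> Rn n \<Longrightarrow> ((\<lambda>t. F (x + Poly_Mapping.single i t)) has_vector_derivative F' x) (at 0)"
      by auto
    from i Suc.prems(2) obtain H' where H': "Ck_Rn n k H'"
      "\<And>x. x \<in> Rn n \<Longrightarrow> ((\<lambda>t. H (x + Poly_Mapping.single i t)) has_vector_derivative H' x) (at 0)"
      by auto
    have "Ck_Rn n k (\<lambda>x. F x * H' x + F' x * H x)"
      using F'(1) H'(1) Suc.prems[THEN Ck_Rn_Suc_imp] by (intro Ck_Rn_add Suc.IH)
    moreover have "((\<lambda>t. F (x + Poly_Mapping.single i t) * H (x + Poly_Mapping.single i t))
        has_vector_derivative F x * H' x + F' x * H x) (at 0)" if "x \<in> Rn n" for x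
      using has_vector_derivative_mult[OF F'(2)[OF that] H'(2)[OF that]] by simp
    ultimately show "\<exists>F'. Ck_Rn n k F' \<and> (\<forall>x\<in>Rn n. ((\<lambda>t. F (x + Poly_Mapping.single i t)
        * H (x + Poly_Mapping.single i t)) has_vector_derivative F' x) (at 0))"
      by blast
  qed
qed

lemma Ck_Rn_compose:
  fixes F :: "(nat \<Rightarrow>\<^sub>0 real) \<Rightarrow> real"
  assumes "smooth_real \<kappa>" "Ck_Rn n k F"
  shows "Ck_Rn n k (\<lambda>x. \<kappa> (F x))"
  using assms
proof (induction k arbitrary: \<kappa>)
  case (0 \<kappa>)
  then show ?case
    using continuous_on_compose2[of UNIV \<kappa> "Rn n" F] smooth_real_isCont[OF 0(1), where m = 0]
    by (simp add: continuous_at_imp_continuous_on)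
next
  case (Suc k \<kappa>)
  show ?case unfolding Ck_Rn.simps
  proof (intro conjI allI impI)
    show "continuous_on (Rn n) (\<lambda>x. \<kappa> (F x))"
      using continuous_on_compose2[of UNIV \<kappa> "Rn n" F] smooth_real_isCont[OF Suc.prems(1), where m = 0]
        Suc.prems(2) by (simp add: continuous_at_imp_continuous_on)
    fix i assume i: "i < n"
    with Suc.prems(2) obtain F' where F': "Ck_Rn n k F'"
      "\<And>x. x \<in> Rn n \<Longrightarrow> ((\<lambda>t. F (x + Poly_Mapping.single i t)) has_vector_derivative F' x) (at 0)"
      by auto
    have "Ck_Rn n k (\<lambda>x. F' x * deriv \<kappa> (F x))"
      by (intro Ck_Rn_mult F'(1) Suc.IH[OF smooth_real_deriv[OF Suc.prems(1)]]
          Ck_Rn_Suc_imp[OF Suc.prems(2)])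
    moreover have "((\<lambda>t. \<kappa> (F (x + Poly_Mapping.single i t)))
        has_vector_derivative F' x * deriv \<kappa> (F x)) (at 0)" if "x \<in> Rn n" for x
    proof -
      have "(\<kappa> has_real_derivative deriv \<kappa> (F x)) (at (F (x + Poly_Mapping.single i 0)))"
        using smooth_real_DERIV[OF Suc.prems(1), where m = 0] by simp
      from DERIV_chain2[where g = "\<lambda>t. F (x + Poly_Mapping.single i t)", OF this] F'(2)[OF that] show ?thesis
        by (simp add: mult.commute flip: has_real_derivative_iff_has_vector_derivative)
    qed
    ultimately show "\<exists>F'. Ck_Rn n k F' \<and> (\<forall>x\<in>Rn n.
        ((\<lambda>t. \<kappa> (F (x + Poly_Mapping.single i t))) has_vector_derivative F' x) (at 0))"
      by blast
  qed
qed

definition complex_to_R2 :: "complex \<Rightarrow> (nat \<Rightarrow>\<^sub>0 real)"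
  where "complex_to_R2 z = Poly_Mapping.single 0 (Re z) + Poly_Mapping.single 1 (Im z)"

definition R2_to_complex :: "(nat \<Rightarrow>\<^sub>0 real) \<Rightarrow> complex"
  where "R2_to_complex x = Complex (Poly_Mapping.lookup x 0) (Poly_Mapping.lookup x 1)"

lemma bounded_linear_complex_to_R2: "bounded_linear complex_to_R2"
  unfolding complex_to_R2_def[abs_def]
  by (intro bounded_linear_add bounded_linear_compose[OF bounded_linear_single]
      bounded_linear_Re bounded_linear_Im)

lemma R2_to_complex_of_complex [simp]: "R2_to_complex (complex_to_R2 z) = z"
  by (simp add: R2_to_complex_def complex_to_R2_def lookup_add lookup_single)

lemma complex_to_R2_in_Rn [simp]: "complex_to_R2 z \<in> Rn 2"
proof -
  have "Poly_Mapping.keys (complex_to_R2 z) \<subseteq> {0} \<union> {1}"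
    unfolding complex_to_R2_def
    by (intro order.trans[OF Poly_Mapping.keys_add] Un_mono) auto
  then show ?thesis by (auto simp: Rn_def)
qed

lemma cmod_le_norm_complex_to_R2: "cmod z \<le> 2 * norm (complex_to_R2 z)"
proof -
  have "cmod z \<le> \<bar>Re z\<bar> + \<bar>Im z\<bar>" by (rule cmod_le)
  also have "\<bar>Re z\<bar> \<le> norm (complex_to_R2 z)"
    using norm_lookup_le[of "complex_to_R2 z" 0]
    by (simp add: complex_to_R2_def lookup_add lookup_single)
  also have "\<bar>Im z\<bar> \<le> norm (complex_to_R2 z)"
    using norm_lookup_le[of "complex_to_R2 z" 1]
    by (simp add: complex_to_R2_def lookup_add lookup_single)
  finally show ?thesis by simp
qed

lemma smooth_field_rotation:
  assumes "smooth_real \<kappa>"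
  shows "smooth_field_Rn 2 (\<lambda>x. complex_to_R2 (rotation_field \<kappa> (R2_to_complex x)))"
proof -
  let ?r = "\<lambda>x. Poly_Mapping.lookup x 0 * Poly_Mapping.lookup x 0
    + Poly_Mapping.lookup x 1 * Poly_Mapping.lookup x (1::nat)"
  have r: "(cmod (R2_to_complex x))\<^sup>2 = ?r x" for x
    by (simp add: cmod_power2 R2_to_complex_def flip: power2_eq_square)
  have eq: "complex_to_R2 (rotation_field \<kappa> (R2_to_complex x)) =
      Poly_Mapping.single 0 (- 1 * (\<kappa> (?r x) * Poly_Mapping.lookup x 1)) +
      Poly_Mapping.single 1 (\<kappa> (?r x) * Poly_Mapping.lookup x 0)" for x
    unfolding complex_to_R2_def Re_rotation_field Im_rotation_field r
    by (simp add: R2_to_complex_def)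
  have "Ck_Rn 2 k (\<lambda>x. complex_to_R2 (rotation_field \<kappa> (R2_to_complex x)))" for k
    unfolding eq
    by (intro Ck_Rn_add Ck_Rn_bounded_linear[OF bounded_linear_single] Ck_Rn_mult Ck_Rn_const
        Ck_Rn_compose[OF assms] Ck_Rn_lookup)
  then show ?thesis by (auto simp: smooth_field_Rn_def)
qed

lemma cis_has_vector_derivative:
  "((\<lambda>t. cis (\<omega> * t)) has_vector_derivative of_real \<omega> * (\<i> * cis (\<omega> * t))) (at t)"
  unfolding has_vector_derivative_def
  by (rule has_derivative_eq_rhs, (rule derivative_intros)+) (simp add: scaleR_conv_of_real mult_ac)

text \<open>
  The order of a method is a statement about fields on the spaces \<open>Rn n\<close>. Here it is used only for
  \<open>n = 2\<close> and the initial value \<open>1\<close>, after carrying the field, its stages and the solution \<open>cis\<close> over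
  from the complex plane.
\<close>

lemma rk_order_rotation:
  assumes "rk_has_order s a b p" and \<kappa>: "smooth_real \<kappa>"
    and Z: "rk_stage_family UNIV s a (rotation_field \<kappa>) 1 Z"
  shows "(\<lambda>h. cmod (1 + h *\<^sub>R rk_direction s b (rotation_field \<kappa>) (Z h) - cis (\<kappa> 1 * h)))
    \<in> O[at_right 0](\<lambda>h. h ^ (p + 1))"
proof -
  define F where "F x = complex_to_R2 (rotation_field \<kappa> (R2_to_complex x))" for x
  interpret E: bounded_linear complex_to_R2 by (rule bounded_linear_complex_to_R2)
  note lin = E.add E.scaleR E.sum
  have "rk_stages (Rn 2) s a F (complex_to_R2 1) h (\<lambda>i. complex_to_R2 (Z h i))"
    if "rk_stages UNIV s a (rotation_field \<kappa>) 1 h (Z h)" for h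
    unfolding rk_stages_def
  proof (intro ballI conjI)
    fix i assume "i \<in> {1..s}"
    then have "Z h i = 1 + h *\<^sub>R (\<Sum>j=1..s. a i j *\<^sub>R rotation_field \<kappa> (Z h j))"
      using that by (auto simp: rk_stages_def)
    then have "complex_to_R2 (Z h i) =
        complex_to_R2 (1 + h *\<^sub>R (\<Sum>j=1..s. a i j *\<^sub>R rotation_field \<kappa> (Z h j)))"
      by simp
    also have "\<dots> = complex_to_R2 1 + h *\<^sub>R (\<Sum>j=1..s. a i j *\<^sub>R F (complex_to_R2 (Z h j)))"
      by (simp add: lin F_def)
    finally show "complex_to_R2 (Z h i) = \<dots>" .
  qed auto
  then have "rk_stage_family (Rn 2) s a F (complex_to_R2 1) (\<lambda>h i. complex_to_R2 (Z h i))"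
    using Z by (auto simp: rk_stage_family_def elim!: eventually_mono intro!: E.tendsto)
  moreover have "ode_solution (Rn 2) F (complex_to_R2 1) 1 (\<lambda>t. complex_to_R2 (cis (\<kappa> 1 * t)))"
    using E.has_vector_derivative[OF cis_has_vector_derivative]
    by (auto simp: ode_solution_def F_def rotation_field_def)
  moreover have "smooth_field_Rn 2 F"
    using smooth_field_rotation[OF \<kappa>] by (simp add: F_def[abs_def])
  ultimately have bound: "(\<lambda>h. norm (complex_to_R2 1 + h *\<^sub>R rk_direction s b F (\<lambda>i. complex_to_R2 (Z h i))
      - complex_to_R2 (cis (\<kappa> 1 * h)))) \<in> O[at_right 0](\<lambda>h. h ^ (p + 1))"
    by (intro assms(1)[unfolded rk_has_order_def, rule_format]) simp_all
  have "(\<lambda>h. complex_to_R2 1 + h *\<^sub>R rk_direction s b F (\<lambda>i. complex_to_R2 (Z h i))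
      - complex_to_R2 (cis (\<kappa> 1 * h))) =
    (\<lambda>h. complex_to_R2 (1 + h *\<^sub>R rk_direction s b (rotation_field \<kappa>) (Z h) - cis (\<kappa> 1 * h)))"
    by (simp add: lin E.diff rk_direction_def F_def)
  then have "(\<lambda>h. norm (complex_to_R2 (1 + h *\<^sub>R rk_direction s b (rotation_field \<kappa>) (Z h)
      - cis (\<kappa> 1 * h)))) \<in> O[at_right 0](\<lambda>h. h ^ (p + 1))"
    using bound by (simp only: fun_eq_iff)
  from landau_o.big_trans[OF _ this] show ?thesis
    by this (rule bigoI[of _ 2], simp add: cmod_le_norm_complex_to_R2)
qed


section \<open>The relaxed step on the unit circle\<close>

lemma bigo_cancel_h:
  assumes "(\<lambda>h. h * f h) \<in> O[at_right 0](\<lambda>h::real. h ^ Suc n)"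
  shows "f \<in> O[at_right 0](\<lambda>h::real. h ^ n)"
proof -
  have nz: "\<forall>\<^sub>F h in at_right (0::real). h \<noteq> 0"
    using eventually_at_right_less[of "0::real"] by eventually_elim simp
  have "(\<lambda>h. h * f h) \<in> O[at_right 0](\<lambda>h::real. h * h ^ n)"
    using assms by simp
  then show ?thesis
    using landau_o.big.mult_cancel_left[OF bigtheta_refl nz] by blast
qed

lemma sin_minus_bigo:
  assumes "f \<in> O[at_right 0](\<lambda>h::real. h ^ n)"
  shows "(\<lambda>h. sin (f h) - f h) \<in> O[at_right 0](\<lambda>h. h ^ (3 * n))"
proof (rule landau_o.big_trans)
  show "(\<lambda>h. sin (f h) - f h) \<in> O[at_right 0](\<lambda>h. f h ^ 3)"
  proof (rule bigoI[of _ 1], rule always_eventually, rule allI)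
    fix h
    have "\<bar>sin (f h) - f h\<bar> \<le> inverse (fact 3) * \<bar>f h\<bar> ^ 3"
      using Maclaurin_sin_bound[of "f h" 3] by (simp add: sin_coeff_def numeral_3_eq_3)
    also have "\<dots> \<le> 1 * \<bar>f h\<bar> ^ 3"
      by (intro mult_right_mono) (auto simp: fact_numeral)
    finally show "norm (sin (f h) - f h) \<le> 1 * norm (f h ^ 3)"
      by (simp add: power_abs)
  qed
  show "(\<lambda>h. f h ^ 3) \<in> O[at_right 0](\<lambda>h. h ^ (3 * n))"
    using landau_o.big_power[OF assms, of 3] by (simp add: power_mult mult.commute flip: power_mult)
qed

lemma cos_minus_one_bigo:
  assumes "f \<in> O[at_right 0](\<lambda>h::real. h ^ n)"
  shows "(\<lambda>h. cos (f h) - 1) \<in> O[at_right 0](\<lambda>h. h ^ (2 * n))"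
proof (rule landau_o.big_trans)
  show "(\<lambda>h. cos (f h) - 1) \<in> O[at_right 0](\<lambda>h. f h ^ 2)"
  proof (rule bigoI[of _ 1], rule always_eventually, rule allI)
    fix h
    have "\<bar>sin (f h / 2)\<bar> \<le> \<bar>f h / 2\<bar>" by (rule abs_sin_x_le_abs_x)
    then have "(sin (f h / 2))\<^sup>2 \<le> (f h / 2)\<^sup>2" by (rule abs_le_square_iff[THEN iffD1])
    then have "4 * (sin (f h / 2))\<^sup>2 \<le> (f h)\<^sup>2" by (simp add: power_divide)
    then have "2 * (sin (f h / 2))\<^sup>2 \<le> (f h)\<^sup>2"
      using zero_le_power2[of "sin (f h / 2)"] by linarith
    moreover have "cos (f h) - 1 = - 2 * (sin (f h / 2))\<^sup>2"
      using cos_double_sin[of "f h / 2"] by simp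
    ultimately show "norm (cos (f h) - 1) \<le> 1 * norm (f h ^ 2)" by simp
  qed
  show "(\<lambda>h. f h ^ 2) \<in> O[at_right 0](\<lambda>h. h ^ (2 * n))"
    using landau_o.big_power[OF assms, of 2] by (simp add: mult.commute flip: power_mult)
qed

lemma sin_bigo:
  assumes "f \<in> O[at_right 0](\<lambda>h::real. h ^ n)"
  shows "(\<lambda>h. sin (f h)) \<in> O[at_right 0](\<lambda>h. h ^ n)"
  using _ assms
  by (rule landau_o.big_trans) (rule bigoI[of _ 1], simp add: abs_sin_x_le_abs_x)

text \<open>
  On the right half of the unit circle, \<open>\<bar>w - 1\<bar>\<^sup>2 = 2 (1 - Re w)\<close> is at most
  \<open>2 (1 - Re w) (1 + Re w) = 2 (Im w)\<^sup>2\<close>.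
\<close>

lemma cmod_minus_one_le_Im:
  assumes "cmod w = 1" "Re w \<ge> 0"
  shows "cmod (w - 1) \<le> 2 * \<bar>Im w\<bar>"
proof (rule power2_le_imp_le)
  have sq: "(Re w)\<^sup>2 + (Im w)\<^sup>2 = 1" using assms(1) by (simp flip: cmod_power2)
  then have "Re w \<le> 1" using abs_Re_le_cmod[of w] assms(1) by simp
  then have "1 - Re w \<le> (1 - Re w) * (1 + Re w)"
    using assms(2) by (simp add: mult_le_cancel_left1)
  also have "\<dots> = (Im w)\<^sup>2" using sq by (simp add: algebra_simps power2_eq_square)
  finally have "2 * (1 - Re w) \<le> 2 * (Im w)\<^sup>2" by simp
  also have "\<dots> \<le> 4 * (Im w)\<^sup>2" by simp
  finally have "2 * (1 - Re w) \<le> 4 * (Im w)\<^sup>2" .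
  moreover have "(cmod (w - 1))\<^sup>2 = 2 * (1 - Re w)"
    unfolding cmod_power2 using sq by (simp add: power2_eq_square algebra_simps)
  ultimately show "(cmod (w - 1))\<^sup>2 \<le> (2 * \<bar>Im w\<bar>)\<^sup>2"
    by (simp add: power_mult_distrib)
qed simp

text \<open>
  Let \<open>T = \<gamma> h\<close> be the relaxed time and \<open>\<eta> = T - h\<close>. The radius error of the baseline step is
  \<open>O(h\<^sup>p\<^sup>+\<^sup>1)\<close>, which makes \<open>\<eta>\<close> of size \<open>O(h\<^sup>p)\<close>. The relaxed point, rotated back by the angle \<open>\<omega> T\<close>,
  is a point \<open>w\<close> of the unit circle that should be \<open>1\<close>, so only its imaginary part has to be estimated.
  In it, the shift \<open>\<eta> \<omega>\<close> along the tangent cancels against the additional rotation \<open>sin (\<omega> \<eta>)\<close> up to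
  \<open>O(\<eta>\<^sup>3)\<close>, and \<open>3 p \<ge> p + 2\<close>. That no remainder of size \<open>\<eta>\<^sup>2\<close> occurs is what admits \<open>p = 1\<close>, where
  \<open>\<gamma>\<close> need not be close to \<open>1\<close>.
\<close>

lemma relaxed_error_on_circle:
  fixes d :: "real \<Rightarrow> complex" and \<gamma> :: "real \<Rightarrow> real"
  assumes p: "p \<ge> 1" and \<omega>: "\<omega> \<noteq> 0"
    and err: "(\<lambda>h. cmod (1 + h *\<^sub>R d h - cis (\<omega> * h))) \<in> O[at_right 0](\<lambda>h. h ^ (p + 1))"
    and phase: "(\<lambda>h. h * Im (d h) - sin (\<omega> * h)) \<in> O[at_right 0](\<lambda>h. h ^ (p + 2))"
    and relax: "\<forall>\<^sub>F h in at_right 0. d h \<noteq> 0 \<longrightarrow> \<gamma> h \<noteq> 0 \<and> cmod (1 + (\<gamma> h * h) *\<^sub>R d h) = 1"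
  shows "((\<lambda>h. \<gamma> h * h) \<longlongrightarrow> 0) (at_right 0)"
    and "(\<lambda>h. cmod (1 + (\<gamma> h * h) *\<^sub>R d h - cis (\<omega> * (\<gamma> h * h))))
      \<in> O[at_right 0](\<lambda>h. h ^ (p + 2))"
proof -
  define X where "X h = Re (d h)" for h
  define Y where "Y h = Im (d h)" for h
  define D where "D h = (cmod (d h))\<^sup>2" for h
  define r where "r h = 1 + h * X h - cos (\<omega> * h)" for h
  define q where "q h = h * Y h - sin (\<omega> * h)" for h
  define T where "T h = \<gamma> h * h" for h
  define \<eta> where "\<eta> h = T h - h" for h
  have pos: "\<forall>\<^sub>F h in at_right (0::real). h > 0" by (rule eventually_at_right_less)
  have r: "r \<in> O[at_right 0](\<lambda>h. h ^ (p + 1))"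
  proof (rule landau_o.big_trans[OF _ err], rule bigoI[of _ 1], rule always_eventually, rule allI)
    fix h
    show "norm (r h) \<le> 1 * norm (cmod (1 + h *\<^sub>R d h - cis (\<omega> * h)))"
      using abs_Re_le_cmod[of "1 + h *\<^sub>R d h - cis (\<omega> * h)"] by (simp add: r_def X_def)
  qed
  have q: "q \<in> O[at_right 0](\<lambda>h. h ^ (p + 2))"
    using phase by (simp add: q_def[abs_def] Y_def)
  have lin: "(\<lambda>h. \<omega> * h) \<in> O[at_right 0](\<lambda>h. h ^ 1)" by simp
  have "(\<lambda>h. r h + (cos (\<omega> * h) - 1)) \<in> O[at_right 0](\<lambda>h. h ^ 2)"
    using cos_minus_one_bigo[OF lin] bigo_weaken_power[OF r, of 2] p
    by (intro sum_in_bigo(1)) simp_all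
  then have X: "X \<in> O[at_right 0](\<lambda>h. h ^ 1)"
    by (intro bigo_cancel_h[of X 1]) (simp add: r_def numeral_2_eq_2)
  have "(\<lambda>h. q h + (sin (\<omega> * h) - \<omega> * h)) \<in> O[at_right 0](\<lambda>h. h ^ 3)"
    using sin_minus_bigo[OF lin] bigo_weaken_power[OF q, of 3] p
    by (intro sum_in_bigo(1)) simp_all
  then have Y: "(\<lambda>h. Y h - \<omega>) \<in> O[at_right 0](\<lambda>h. h ^ 2)"
    by (intro bigo_cancel_h[of "\<lambda>h. Y h - \<omega>" 2]) (simp add: q_def numeral_3_eq_3 algebra_simps)
  have X0: "(X \<longlongrightarrow> 0) (at_right 0)" by (rule tendsto_0_if_bigo_power[OF X]) simp
  have Y0: "(Y \<longlongrightarrow> \<omega>) (at_right 0)"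
    using tendsto_0_if_bigo_power[OF Y] by (simp add: LIM_zero_iff)
  have D_eq: "D h = (X h)\<^sup>2 + (Y h)\<^sup>2" for h by (simp add: D_def X_def Y_def cmod_power2)
  have "((\<lambda>h. (X h)\<^sup>2 + (Y h)\<^sup>2) \<longlongrightarrow> 0\<^sup>2 + \<omega>\<^sup>2) (at_right 0)"
    by (intro tendsto_intros X0 Y0)
  then have D0: "(D \<longlongrightarrow> \<omega>\<^sup>2) (at_right 0)" by (simp flip: D_eq)
  have D_pos: "\<forall>\<^sub>F h in at_right 0. D h > 0"
    using order_tendstoD(1)[OF D0, of 0] \<omega> by simp
  \<comment> \<open>Since \<open>d\<close> tends to \<open>\<i> \<omega>\<close>, the guard \<open>d h \<noteq> 0\<close> of the relaxation condition holds for small \<open>h\<close>.\<close>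
  have good: "\<forall>\<^sub>F h in at_right 0. h > 0 \<and> D h > 0 \<and> \<gamma> h \<noteq> 0 \<and> cmod (1 + T h *\<^sub>R d h) = 1"
    using relax pos D_pos by eventually_elim (auto simp: D_def T_def)
  \<comment> \<open>The defect \<open>\<bar>1 + h d\<bar>\<^sup>2 - 1\<close> of the baseline step, written in terms of its errors \<open>r\<close> and \<open>q\<close>.\<close>
  define Q where "Q h = 2 * cos (\<omega> * h) * r h + r h * r h + 2 * sin (\<omega> * h) * q h + q h * q h" for h
  have bounded: "(\<lambda>h. 2 * cos (\<omega> * h)) \<in> O[at_right 0](\<lambda>h. h ^ 0)"
    "(\<lambda>h. 2 * sin (\<omega> * h)) \<in> O[at_right 0](\<lambda>h. h ^ 0)"
    by (auto intro!: bigoI[of _ 1] always_eventually)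
  have bounded': "r \<in> O[at_right 0](\<lambda>h. h ^ 0)" "q \<in> O[at_right 0](\<lambda>h. h ^ 0)"
    by (rule bigo_weaken_power[OF r] bigo_weaken_power[OF q]; simp)+
  have q': "q \<in> O[at_right 0](\<lambda>h. h ^ (p + 1))" by (rule bigo_weaken_power[OF q]) simp
  have Q: "Q \<in> O[at_right 0](\<lambda>h. h ^ (p + 1))"
    unfolding Q_def
    using bigo_mult_power[OF bounded(1) r] bigo_mult_power[OF bounded'(1) r]
      bigo_mult_power[OF bounded(2) q'] bigo_mult_power[OF bounded'(2) q']
    by (intro sum_in_bigo) simp_all
  have Q_eq: "\<forall>\<^sub>F h in at_right 0. h * (\<eta> h * D h) = - Q h"
    using good
  proof eventually_elim
    case (elim h)
    have "(1 + T h * X h)\<^sup>2 + (T h * Y h)\<^sup>2 = 1"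
      using elim cmod_power2[of "1 + T h *\<^sub>R d h"] by (simp add: X_def Y_def)
    then have "T h * (2 * X h + T h * D h) = 0"
      by (simp add: D_eq power2_eq_square algebra_simps)
    \<comment> \<open>The line through \<open>1\<close> in direction \<open>d\<close> meets the circle at parameter \<open>0\<close> and at \<open>T\<close>.\<close>
    then have 1: "2 * X h + T h * D h = 0" using elim by (simp add: T_def)
    have "Q h = (1 + h * X h)\<^sup>2 + (h * Y h)\<^sup>2 - 1"
      using sin_cos_squared_add[of "\<omega> * h"]
      by (simp add: Q_def r_def q_def power2_eq_square algebra_simps)
    also have "\<dots> = h * (2 * X h + h * D h)"
      by (simp add: D_eq power2_eq_square algebra_simps)
    also have "\<dots> = h * (2 * X h + T h * D h) - h * (\<eta> h * D h)"
      by (simp add: \<eta>_def algebra_simps)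
    finally show ?case by (simp add: 1)
  qed
  have "(\<lambda>h. h * (\<eta> h * D h)) \<in> O[at_right 0](\<lambda>h. h ^ Suc p)"
    by (subst landau_o.big.in_cong[OF Q_eq]) (use Q in simp)
  then have "(\<lambda>h. \<eta> h * D h) \<in> O[at_right 0](\<lambda>h. h ^ p)"
    by (rule bigo_cancel_h)
  moreover have "(\<lambda>h. inverse (D h)) \<in> O[at_right 0](\<lambda>h. h ^ 0)"
    using bigo_1_if_tendsto[OF tendsto_inverse[OF D0]] \<omega> by simp
  ultimately have "(\<lambda>h. (\<eta> h * D h) * inverse (D h)) \<in> O[at_right 0](\<lambda>h. h ^ (p + 0))"
    by (rule bigo_mult_power)
  moreover have "\<forall>\<^sub>F h in at_right 0. (\<eta> h * D h) * inverse (D h) = \<eta> h"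
    using D_pos by eventually_elim simp
  ultimately have \<eta>: "\<eta> \<in> O[at_right 0](\<lambda>h. h ^ p)"
    using landau_o.big.in_cong[of "\<lambda>h. (\<eta> h * D h) * inverse (D h)" \<eta>] by simp
  have "(\<lambda>h. \<eta> h + h) \<in> O[at_right 0](\<lambda>h. h ^ 1)"
    using bigo_weaken_power[OF \<eta> p] by (intro sum_in_bigo(1)) auto
  then have T: "T \<in> O[at_right 0](\<lambda>h. h ^ 1)" by (simp add: \<eta>_def)
  then have T0: "(T \<longlongrightarrow> 0) (at_right 0)" by (rule tendsto_0_if_bigo_power) simp
  then show "((\<lambda>h. \<gamma> h * h) \<longlongrightarrow> 0) (at_right 0)" by (simp add: T_def[abs_def])
  have \<omega>T: "(\<lambda>h. \<omega> * T h) \<in> O[at_right 0](\<lambda>h. h ^ 1)" and \<omega>\<eta>: "(\<lambda>h. \<omega> * \<eta> h) \<in> O[at_right 0](\<lambda>h. h ^ p)"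
    using T \<eta> by simp_all
  have cosb: "(\<lambda>h. cos (\<omega> * T h)) \<in> O[at_right 0](\<lambda>h. h ^ 0)"
    by (auto intro!: bigoI[of _ 1] always_eventually)
  define w where "w h = (1 + T h *\<^sub>R d h) * cis (- (\<omega> * T h))" for h
  \<comment> \<open>The imaginary part of \<open>w\<close>, arranged so that each summand is small by itself.\<close>
  define I where "I h = - (sin (\<omega> * \<eta> h) - \<omega> * \<eta> h) + q h * cos (\<omega> * T h) - r h * sin (\<omega> * T h)
    + \<eta> h * (Y h - \<omega>) * cos (\<omega> * T h) + \<eta> h * \<omega> * (cos (\<omega> * T h) - 1) - \<eta> h * X h * sin (\<omega> * T h)" for h
  have Im_w: "Im (w h) = I h" for h
  proof -
    have "sin (\<omega> * \<eta> h) = sin (\<omega> * T h - \<omega> * h)" by (simp add: \<eta>_def algebra_simps)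
    then have s: "sin (\<omega> * \<eta> h) = sin (\<omega> * T h) * cos (\<omega> * h) - cos (\<omega> * T h) * sin (\<omega> * h)"
      by (simp add: sin_diff)
    have "Im (w h) = (h * Y h + \<eta> h * Y h) * cos (\<omega> * T h) - (1 + h * X h + \<eta> h * X h) * sin (\<omega> * T h)"
      by (simp add: w_def X_def Y_def \<eta>_def algebra_simps)
    also have "\<dots> = I h"
      unfolding I_def s r_def q_def by (simp add: algebra_simps)
    finally show ?thesis .
  qed
  have "I \<in> O[at_right 0](\<lambda>h. h ^ (p + 2))"
    unfolding I_def
  proof (intro sum_in_bigo)
    show "(\<lambda>h. - (sin (\<omega> * \<eta> h) - \<omega> * \<eta> h)) \<in> O[at_right 0](\<lambda>h. h ^ (p + 2))"
      using bigo_weaken_power[OF sin_minus_bigo[OF \<omega>\<eta>], of "p + 2"] p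
      by (subst landau_o.big.uminus_in_iff) simp
    show "(\<lambda>h. q h * cos (\<omega> * T h)) \<in> O[at_right 0](\<lambda>h. h ^ (p + 2))"
      using bigo_mult_power[OF q cosb] by simp
    show "(\<lambda>h. r h * sin (\<omega> * T h)) \<in> O[at_right 0](\<lambda>h. h ^ (p + 2))"
      using bigo_mult_power[OF r sin_bigo[OF \<omega>T]] by simp
    show "(\<lambda>h. \<eta> h * (Y h - \<omega>) * cos (\<omega> * T h)) \<in> O[at_right 0](\<lambda>h. h ^ (p + 2))"
      using bigo_mult_power[OF bigo_mult_power[OF \<eta> Y] cosb] by simp
    show "(\<lambda>h. \<eta> h * \<omega> * (cos (\<omega> * T h) - 1)) \<in> O[at_right 0](\<lambda>h. h ^ (p + 2))"
      using bigo_mult_power[OF \<omega>\<eta> cos_minus_one_bigo[OF \<omega>T]] by (simp add: mult_ac)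
    show "(\<lambda>h. \<eta> h * X h * sin (\<omega> * T h)) \<in> O[at_right 0](\<lambda>h. h ^ (p + 2))"
      using bigo_mult_power[OF bigo_mult_power[OF \<eta> X] sin_bigo[OF \<omega>T]] by simp
  qed
  have "((\<lambda>h. (1 + T h * X h) * cos (\<omega> * T h) + T h * Y h * sin (\<omega> * T h)) \<longlongrightarrow>
      (1 + 0 * 0) * cos (\<omega> * 0) + 0 * \<omega> * sin (\<omega> * 0)) (at_right 0)"
    by (intro tendsto_intros T0 X0 Y0)
  moreover have "Re (w h) = (1 + T h * X h) * cos (\<omega> * T h) + T h * Y h * sin (\<omega> * T h)" for h
    by (simp add: w_def X_def Y_def)
  ultimately have "((\<lambda>h. Re (w h)) \<longlongrightarrow> 1) (at_right 0)" by simp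
  then have "\<forall>\<^sub>F h in at_right 0. Re (w h) > 0"
    by (rule order_tendstoD) simp
  with good have "\<forall>\<^sub>F h in at_right 0. norm (cmod (1 + T h *\<^sub>R d h - cis (\<omega> * T h))) \<le> 2 * norm (I h)"
  proof eventually_elim
    case (elim h)
    have "1 + T h *\<^sub>R d h - cis (\<omega> * T h) = (w h - 1) * cis (\<omega> * T h)"
      by (simp add: w_def left_diff_distrib mult.assoc cis_mult)
    then have "cmod (1 + T h *\<^sub>R d h - cis (\<omega> * T h)) = cmod (w h - 1)"
      by (simp add: norm_mult)
    also have "\<dots> \<le> 2 * \<bar>Im (w h)\<bar>"
      using elim by (intro cmod_minus_one_le_Im) (auto simp: w_def norm_mult)
    finally show ?case by (simp add: Im_w)
  qed
  then have "(\<lambda>h. cmod (1 + T h *\<^sub>R d h - cis (\<omega> * T h))) \<in> O[at_right 0](I)"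
    by (rule bigoI)
  then show "(\<lambda>h. cmod (1 + (\<gamma> h * h) *\<^sub>R d h - cis (\<omega> * (\<gamma> h * h)))) \<in> O[at_right 0](\<lambda>h. h ^ (p + 2))"
    using landau_o.big_trans[OF _ \<open>I \<in> _\<close>] by (simp add: T_def)
qed


section \<open>Stages near an equilibrium\<close>

text \<open>
  For small \<open>h\<close> the system \<open>e = h a q\<close> with \<open>\<bar>q\<bar> \<le> M \<bar>e\<bar>\<close> is a contraction around zero, in the norm
  \<open>\<Sum>\<^sub>i \<bar>e\<^sub>i\<bar>\<close>. It serves to show that the stages are exactly where they are expected: at an
  equilibrium, and in an invariant plane.
\<close>

lemma small_linear_system_trivial:
  fixes e q :: "real \<Rightarrow> nat \<Rightarrow> 'a::real_normed_vector"
  assumes eq: "\<forall>\<^sub>F h in at_right 0. \<forall>i\<in>{1..s}. e h i = h *\<^sub>R (\<Sum>j=1..s. a i j *\<^sub>R q h j)"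
    and bound: "\<And>j. j \<in> {1..s} \<Longrightarrow> \<forall>\<^sub>F h in at_right 0. norm (q h j) \<le> M * norm (e h j)"
  shows "\<forall>\<^sub>F h in at_right 0. \<forall>i\<in>{1..s}. e h i = 0"
proof -
  define A where "A = (\<Sum>i=1..s. \<Sum>j=1..s. \<bar>a i j\<bar>)"
  have A: "(\<Sum>i=1..s. \<bar>a i j\<bar>) \<le> A" if "j \<in> {1..s}" for j
    unfolding A_def using that by (intro sum_mono member_le_sum) auto
  have "((\<lambda>h. h * (A * \<bar>M\<bar>)) \<longlongrightarrow> 0 * (A * \<bar>M\<bar>)) (at_right 0)"
    by (intro tendsto_intros)
  then have small: "\<forall>\<^sub>F h in at_right 0. h * (A * \<bar>M\<bar>) < 1"
    by (auto intro: order_tendstoD)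
  have "\<forall>\<^sub>F h in at_right 0. \<forall>j\<in>{1..s}. norm (q h j) \<le> M * norm (e h j)"
    using bound by (simp add: eventually_ball_finite)
  with eq small eventually_at_right_less[of "0::real"] show ?thesis
  proof eventually_elim
    case (elim h)
    let ?S = "\<Sum>i=1..s. norm (e h i)"
    have "?S \<le> (\<Sum>i=1..s. h * (\<Sum>j=1..s. \<bar>a i j\<bar> * (\<bar>M\<bar> * norm (e h j))))"
    proof (rule sum_mono)
      fix i assume i: "i \<in> {1..s}"
      have "norm (e h i) = h * norm (\<Sum>j=1..s. a i j *\<^sub>R q h j)"
        using elim i by simp
      also have "\<dots> \<le> h * (\<Sum>j=1..s. \<bar>a i j\<bar> * (\<bar>M\<bar> * norm (e h j)))"
      proof (intro mult_left_mono sum_norm_le)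
        fix j assume "j \<in> {1..s}"
        then have "norm (q h j) \<le> M * norm (e h j)" using elim by blast
        also have "\<dots> \<le> \<bar>M\<bar> * norm (e h j)" by (intro mult_right_mono) auto
        finally show "norm (a i j *\<^sub>R q h j) \<le> \<bar>a i j\<bar> * (\<bar>M\<bar> * norm (e h j))"
          by (simp add: mult_left_mono)
      qed (use elim in auto)
      finally show "norm (e h i) \<le> h * (\<Sum>j=1..s. \<bar>a i j\<bar> * (\<bar>M\<bar> * norm (e h j)))" .
    qed
    also have "\<dots> = h * (\<Sum>j=1..s. (\<Sum>i=1..s. \<bar>a i j\<bar>) * (\<bar>M\<bar> * norm (e h j)))"
      unfolding sum_distrib_left sum_distrib_right by (rule sum.swap)
    also have "\<dots> \<le> h * (\<Sum>j=1..s. A * (\<bar>M\<bar> * norm (e h j)))"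
      using elim A by (intro mult_left_mono sum_mono mult_right_mono) auto
    also have "\<dots> = h * (A * \<bar>M\<bar>) * ?S"
      by (simp add: sum_distrib_left mult_ac)
    finally have "(1 - h * (A * \<bar>M\<bar>)) * ?S \<le> 0" by (simp add: algebra_simps)
    with elim have "?S \<le> 0" by (simp add: mult_le_0_iff)
    moreover have "?S \<ge> 0" by (intro sum_nonneg) auto
    ultimately have "?S = 0" by simp
    then show ?case by (simp add: sum_nonneg_eq_0_iff)
  qed
qed

text \<open>
  A differentiable field that vanishes at \<open>u0\<close> grows at most linearly with the distance from \<open>u0\<close>, so
  the differences \<open>Y h i - u0\<close> solve a system as in \<open>small_linear_system_trivial\<close>.
\<close>

lemma rk_stages_at_equilibrium:
  assumes f': "(f has_derivative f') (at u0)" and eq: "f u0 = 0"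
    and Y: "rk_stage_family UNIV s a f u0 Y"
  shows "\<forall>\<^sub>F h in at_right 0. \<forall>i\<in>{1..s}. Y h i = u0"
proof -
  interpret f': bounded_linear f' using f' by (rule has_derivative_bounded_linear)
  obtain K where K: "\<And>v. norm (f' v) \<le> norm v * K" using f'.bounded by blast
  obtain \<delta> where \<delta>: "\<delta> > 0"
    "\<And>y. norm (y - u0) < \<delta> \<Longrightarrow> norm (f y - f u0 - f' (y - u0)) \<le> 1 * norm (y - u0)"
    using f' unfolding has_derivative_at_alt by (meson zero_less_one)
  have lip: "norm (f y) \<le> (K + 1) * norm (y - u0)" if "norm (y - u0) < \<delta>" for y
  proof -
    have "norm (f y) \<le> norm (f y - f u0 - f' (y - u0)) + norm (f' (y - u0))"
      using norm_triangle_ineq[of "f y - f u0 - f' (y - u0)" "f' (y - u0)"] eq by simp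
    with \<delta>(2)[OF that] K[of "y - u0"] show ?thesis by (simp add: algebra_simps)
  qed
  have "\<forall>\<^sub>F h in at_right 0. \<forall>i\<in>{1..s}. Y h i - u0 = 0"
  proof (rule small_linear_system_trivial)
    show "\<forall>\<^sub>F h in at_right 0. \<forall>i\<in>{1..s}. Y h i - u0 = h *\<^sub>R (\<Sum>j=1..s. a i j *\<^sub>R f (Y h j))"
      using Y by (auto simp: rk_stage_family_def rk_stages_def algebra_simps elim!: eventually_mono)
    fix j assume "j \<in> {1..s}"
    then have "((\<lambda>h. Y h j) \<longlongrightarrow> u0) (at_right 0)" using Y by (auto simp: rk_stage_family_def)
    from tendstoD[OF this \<delta>(1)]
    show "\<forall>\<^sub>F h in at_right 0. norm (f (Y h j)) \<le> (K + 1) * norm (Y h j - u0)"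
      by eventually_elim (auto simp: dist_norm intro: lip)
  qed
  then show ?thesis by simp
qed


section \<open>The Hamiltonian system as a rotation of the plane\<close>

text \<open>
  The complex structure on the phase space. Its sign is chosen such that the Hamiltonian field is a
  multiple of it.
\<close>

definition quarter_turn :: "'a::real_inner \<times> 'a \<Rightarrow> 'a \<times> 'a"
  where "quarter_turn u = (snd u, - fst u)"

lemma bounded_linear_quarter_turn: "bounded_linear quarter_turn"
  unfolding quarter_turn_def[abs_def]
  by (intro bounded_linear_Pair bounded_linear_snd bounded_linear_minus bounded_linear_fst)

lemma quarter_turn_zero: "quarter_turn 0 = 0"
  and quarter_turn_add: "quarter_turn (u + v) = quarter_turn u + quarter_turn v"
  and quarter_turn_diff: "quarter_turn (u - v) = quarter_turn u - quarter_turn v"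
  and quarter_turn_scaleR: "quarter_turn (r *\<^sub>R u) = r *\<^sub>R quarter_turn u"
  by (simp_all add: quarter_turn_def zero_prod_def)

lemma quarter_turn_quarter_turn [simp]: "quarter_turn (quarter_turn u) = - u"
  by (simp add: quarter_turn_def prod_eq_iff)

lemma quarter_turn_inner: "quarter_turn u \<bullet> v = - (u \<bullet> quarter_turn v)"
  by (simp add: quarter_turn_def inner_prod_def)

lemma quarter_turn_inner_self [simp]: "u \<bullet> quarter_turn u = 0" "quarter_turn u \<bullet> u = 0"
  by (simp_all add: quarter_turn_def inner_prod_def inner_commute)

lemma norm_quarter_turn [simp]: "norm (quarter_turn u) = norm u"
  by (simp add: norm_eq_sqrt_inner quarter_turn_def inner_prod_def add.commute)

lemma euclidean_hamiltonian_field_quarter_turn: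
  "euclidean_hamiltonian_field G u = deriv G ((norm u)\<^sup>2 / 2) *\<^sub>R quarter_turn u"
  by (cases u) (simp add: euclidean_hamiltonian_field_def quarter_turn_def norm_Pair)

text \<open>
  Complex scalar multiplication \<open>z u\<close> for the complex structure \<open>quarter_turn\<close>; for \<open>u \<noteq> 0\<close> it
  parametrises the plane spanned by \<open>u\<close> and \<open>quarter_turn u\<close>.
\<close>

definition plane :: "'a::real_inner \<times> 'a \<Rightarrow> complex \<Rightarrow> 'a \<times> 'a"
  where "plane u z = Re z *\<^sub>R u + Im z *\<^sub>R quarter_turn u"

lemma bounded_linear_plane: "bounded_linear (plane u)"
  unfolding plane_def[abs_def]
  by (intro bounded_linear_add bounded_linear_scaleR_left
      bounded_linear_compose[OF bounded_linear_scaleR_left] bounded_linear_Re bounded_linear_Im)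

lemmas plane_linear = bounded_linear.linear[OF bounded_linear_plane]

lemma plane_one [simp]: "plane u 1 = u" and plane_zero [simp]: "plane 0 z = 0"
  by (simp_all add: plane_def quarter_turn_zero)

lemma quarter_turn_plane: "quarter_turn (plane u z) = plane u (\<i> * z)"
  by (simp add: plane_def quarter_turn_add quarter_turn_scaleR)

lemma norm_plane: "norm (plane u z) = cmod z * norm u"
proof (rule power2_eq_imp_eq)
  have "(norm (plane u z))\<^sup>2 = ((Re z)\<^sup>2 + (Im z)\<^sup>2) * (norm u)\<^sup>2"
  proof -
    have "quarter_turn u \<bullet> quarter_turn u = u \<bullet> u"
      by (simp flip: power2_norm_eq_inner)
    then show ?thesis
      unfolding plane_def power2_norm_eq_inner
      by (simp add: inner_add_left inner_add_right power2_eq_square algebra_simps)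
  qed
  then show "(norm (plane u z))\<^sup>2 = (cmod z * norm u)\<^sup>2"
    by (simp add: cmod_power2 power_mult_distrib)
qed auto

lemma plane_eq_zero_iff: "u \<noteq> 0 \<Longrightarrow> plane u z = 0 \<longleftrightarrow> z = 0"
  using norm_plane[of u z] by (metis mult_eq_0_iff norm_eq_zero)

lemma euclidean_hamiltonian_field_plane:
  "euclidean_hamiltonian_field G (plane u z) =
    plane u (rotation_field (\<lambda>x. deriv G ((norm u)\<^sup>2 / 2 * x)) z)"
proof -
  have "(norm (plane u z))\<^sup>2 / 2 = (norm u)\<^sup>2 / 2 * (cmod z)\<^sup>2"
    by (simp add: norm_plane power_mult_distrib)
  then show ?thesis
    by (simp add: euclidean_hamiltonian_field_quarter_turn quarter_turn_plane rotation_field_def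
        linear_scale[OF plane_linear] flip: scaleR_conv_of_real)
qed

text \<open>
  The coordinate of the orthogonal projection to the plane of \<open>u\<close>, the inverse of \<open>plane u\<close> there.
\<close>

definition coord :: "'a::real_inner \<times> 'a \<Rightarrow> 'a \<times> 'a \<Rightarrow> complex"
  where "coord u v = Complex (v \<bullet> u / (norm u)\<^sup>2) (v \<bullet> quarter_turn u / (norm u)\<^sup>2)"

lemma bounded_linear_coord: "bounded_linear (coord u)"
proof -
  have "coord u = (\<lambda>v. (v \<bullet> u) *\<^sub>R of_real (1 / (norm u)\<^sup>2)
      + (v \<bullet> quarter_turn u) *\<^sub>R (\<i> * of_real (1 / (norm u)\<^sup>2)))"
    by (simp add: coord_def complex_eq_iff fun_eq_iff)
  then show ?thesis
    by (simp only: bounded_linear_add bounded_linear_inner_left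
        bounded_linear_compose[OF bounded_linear_scaleR_left bounded_linear_inner_left])
qed

lemma coord_plane:
  assumes "u \<noteq> 0"
  shows "coord u (plane u z) = z"
  using assms dot_square_norm[of "quarter_turn u"]
  by (simp add: coord_def plane_def complex_eq_iff inner_add_left dot_square_norm)

lemma coord_quarter_turn: "coord u (quarter_turn v) = \<i> * coord u v"
  by (simp add: coord_def complex_eq_iff quarter_turn_inner inner_minus_left)

text \<open>
  The field is a scalar multiple of \<open>quarter_turn\<close>, which commutes with the orthogonal projection \<open>P\<close>
  away from the plane. Hence the components \<open>P (Y h i)\<close> solve a homogeneous linear system with bounded
  coefficients and a factor \<open>h\<close>, and vanish for small \<open>h\<close>.
\<close>

lemma hamiltonian_stages_in_plane:
  assumes g: "isCont (deriv G) ((norm u0)\<^sup>2 / 2)"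
    and Y: "rk_stage_family UNIV s a (euclidean_hamiltonian_field G) u0 Y" and u0: "u0 \<noteq> 0"
  shows "\<forall>\<^sub>F h in at_right 0. \<forall>i\<in>{1..s}. Y h i = plane u0 (coord u0 (Y h i))"
proof -
  define P where "P v = v - plane u0 (coord u0 v)" for v
  have "bounded_linear P"
    unfolding P_def[abs_def]
    by (intro bounded_linear_sub bounded_linear_ident
        bounded_linear_compose[OF bounded_linear_plane] bounded_linear_coord)
  then interpret P: bounded_linear P .
  have P_u0: "P u0 = 0"
    using coord_plane[OF u0, of 1] by (simp add: P_def)
  have P_quarter_turn: "P (quarter_turn v) = quarter_turn (P v)" for v
    by (simp add: P_def quarter_turn_diff quarter_turn_plane coord_quarter_turn)
  let ?g = "\<lambda>v. deriv G ((norm v)\<^sup>2 / 2)"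
  have "\<forall>\<^sub>F h in at_right 0. \<forall>i\<in>{1..s}. P (Y h i) = 0"
  proof (rule small_linear_system_trivial)
    show "\<forall>\<^sub>F h in at_right 0. \<forall>i\<in>{1..s}. P (Y h i) =
        h *\<^sub>R (\<Sum>j=1..s. a i j *\<^sub>R (?g (Y h j) *\<^sub>R quarter_turn (P (Y h j))))"
      using conjunct1[OF Y[unfolded rk_stage_family_def]]
    proof (eventually_elim, intro ballI)
      fix h i assume "rk_stages UNIV s a (euclidean_hamiltonian_field G) u0 h (Y h)" "i \<in> {1..s}"
      then have "P (Y h i) = P (u0 + h *\<^sub>R (\<Sum>j=1..s. a i j *\<^sub>R euclidean_hamiltonian_field G (Y h j)))"
        unfolding rk_stages_def by metis
      then show "P (Y h i) = h *\<^sub>R (\<Sum>j=1..s. a i j *\<^sub>R (?g (Y h j) *\<^sub>R quarter_turn (P (Y h j))))"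
        by (simp add: P.add P.scaleR P.sum P_u0 euclidean_hamiltonian_field_quarter_turn P_quarter_turn)
    qed
    fix j assume "j \<in> {1..s}"
    then have "((\<lambda>h. Y h j) \<longlongrightarrow> u0) (at_right 0)" using Y by (auto simp: rk_stage_family_def)
    then have "((\<lambda>h. (norm (Y h j))\<^sup>2 / 2) \<longlongrightarrow> (norm u0)\<^sup>2 / 2) (at_right 0)"
      by (intro tendsto_intros) auto
    from isCont_tendsto_compose[OF g this]
    have "((\<lambda>h. \<bar>?g (Y h j)\<bar>) \<longlongrightarrow> \<bar>?g u0\<bar>) (at_right 0)" by (rule tendsto_rabs)
    then have "\<forall>\<^sub>F h in at_right 0. \<bar>?g (Y h j)\<bar> < \<bar>?g u0\<bar> + 1"
      by (rule order_tendstoD) simp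
    then show "\<forall>\<^sub>F h in at_right 0. norm (?g (Y h j) *\<^sub>R quarter_turn (P (Y h j)))
        \<le> (\<bar>?g u0\<bar> + 1) * norm (P (Y h j))"
      by eventually_elim (simp add: mult_right_mono)
  qed
  then show ?thesis by (simp add: P_def)
qed

lemma rk_stage_family_coord:
  fixes G :: "real \<Rightarrow> real" and u0 :: "'a::real_inner \<times> 'a"
  defines "\<kappa> \<equiv> \<lambda>x. deriv G ((norm u0)\<^sup>2 / 2 * x)"
  assumes Y: "rk_stage_family UNIV s a (euclidean_hamiltonian_field G) u0 Y" and u0: "u0 \<noteq> 0"
    and Y_plane: "\<forall>\<^sub>F h in at_right 0. \<forall>i\<in>{1..s}. Y h i = plane u0 (coord u0 (Y h i))"
  shows "rk_stage_family UNIV s a (rotation_field \<kappa>) 1 (\<lambda>h i. coord u0 (Y h i))"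
  unfolding rk_stage_family_def
proof (intro conjI ballI)
  interpret C: bounded_linear "coord u0" by (rule bounded_linear_coord)
  have coord_u0: "coord u0 u0 = 1" using coord_plane[OF u0, of 1] by simp
  show "\<forall>\<^sub>F h in at_right 0. rk_stages UNIV s a (rotation_field \<kappa>) 1 h (\<lambda>i. coord u0 (Y h i))"
    using Y_plane conjunct1[OF Y[unfolded rk_stage_family_def]]
  proof eventually_elim
    case (elim h)
    have f: "euclidean_hamiltonian_field G (Y h j) = plane u0 (rotation_field \<kappa> (coord u0 (Y h j)))"
      if "j \<in> {1..s}" for j
      using elim(1) that euclidean_hamiltonian_field_plane[of G u0] unfolding \<kappa>_def by metis
    show ?case unfolding rk_stages_def
    proof (intro ballI conjI)
      fix i assume "i \<in> {1..s}"
      then have "Y h i = u0 + h *\<^sub>R (\<Sum>j=1..s. a i j *\<^sub>R euclidean_hamiltonian_field G (Y h j))"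
        using elim(2) unfolding rk_stages_def by blast
      then have "coord u0 (Y h i) =
          coord u0 (u0 + h *\<^sub>R (\<Sum>j=1..s. a i j *\<^sub>R euclidean_hamiltonian_field G (Y h j)))"
        by simp
      also have "\<dots> = 1 + h *\<^sub>R (\<Sum>j=1..s. a i j *\<^sub>R rotation_field \<kappa> (coord u0 (Y h j)))"
        by (simp add: C.add C.scaleR C.sum coord_u0 f coord_plane[OF u0])
      finally show "coord u0 (Y h i) = \<dots>" .
    qed auto
  qed
  fix i assume "i \<in> {1..s}"
  then have "((\<lambda>h. Y h i) \<longlongrightarrow> u0) (at_right 0)" using Y by (auto simp: rk_stage_family_def)
  from C.tendsto[OF this] show "((\<lambda>h. coord u0 (Y h i)) \<longlongrightarrow> 1) (at_right 0)"
    by (simp add: coord_u0)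
qed

text \<open>
  The field is orthogonal to the position, so \<open>\<bar>u\<bar>\<close> is constant and \<open>u\<close> solves the linear equation
  \<open>u' = \<omega> J u\<close>. Rotating \<open>u\<close> back by the angle \<open>\<omega> t\<close> gives a constant.
\<close>

lemma hamiltonian_solution_rotation:
  assumes sol: "ode_solution UNIV (euclidean_hamiltonian_field G) u0 T u" and t: "\<bar>t\<bar> < T"
  shows "u t = plane u0 (cis (deriv G ((norm u0)\<^sup>2 / 2) * t))"
proof -
  define \<omega> where "\<omega> = deriv G ((norm u0)\<^sup>2 / 2)"
  have T: "T > 0" and u_0: "u 0 = u0"
    and u': "\<And>t. t \<in> {-T<..<T} \<Longrightarrow> (u has_vector_derivative euclidean_hamiltonian_field G (u t)) (at t)"
    using sol by (auto simp: ode_solution_def)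
  have const: "F x = F 0" if "\<And>x. x \<in> {-T<..<T} \<Longrightarrow> (F has_vector_derivative 0) (at x)" "x \<in> {-T<..<T}"
    for F :: "real \<Rightarrow> 'b::real_normed_vector" and x
  proof -
    have "\<exists>c. \<forall>x\<in>{-T<..<T}. F x = c"
      by (rule has_vector_derivative_zero_constant[OF convex_real_interval(8)
            has_vector_derivative_at_within[OF that(1)]]) blast+
    then obtain c where "\<And>x. x \<in> {-T<..<T} \<Longrightarrow> F x = c" by blast
    then show ?thesis using that(2) T by simp
  qed
  have norm_u: "(norm (u x))\<^sup>2 = (norm u0)\<^sup>2" if "x \<in> {-T<..<T}" for x
  proof -
    have "u x \<bullet> u x = u 0 \<bullet> u 0"
    proof (rule const[OF _ that])
      fix x assume "x \<in> {-T<..<T}"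
      from u'[OF this] have "(u has_derivative (\<lambda>y. y *\<^sub>R euclidean_hamiltonian_field G (u x))) (at x)"
        by (simp add: has_vector_derivative_def)
      from has_derivative_inner[OF this this]
      show "((\<lambda>t. u t \<bullet> u t) has_vector_derivative 0) (at x)"
        by (simp add: has_vector_derivative_def euclidean_hamiltonian_field_quarter_turn)
    qed
    then show ?thesis by (simp add: u_0 power2_norm_eq_inner)
  qed
  have u'\<omega>: "(u has_vector_derivative \<omega> *\<^sub>R quarter_turn (u x)) (at x)" if "x \<in> {-T<..<T}" for x
    using u'[OF that] by (simp add: euclidean_hamiltonian_field_quarter_turn norm_u[OF that] \<omega>_def)
  \<comment> \<open>The solution in the co-rotating frame.\<close>
  define v where "v x = cos (\<omega> * x) *\<^sub>R u x - sin (\<omega> * x) *\<^sub>R quarter_turn (u x)" for x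
  have tT: "t \<in> {-T<..<T}" using t by auto
  have "v t = v 0"
  proof (rule const[OF _ tT])
    fix x assume x: "x \<in> {-T<..<T}"
    have c: "((\<lambda>x. cos (\<omega> * x)) has_real_derivative - \<omega> * sin (\<omega> * x)) (at x)"
      "((\<lambda>x. sin (\<omega> * x)) has_real_derivative \<omega> * cos (\<omega> * x)) (at x)"
      by (auto intro!: derivative_eq_intros)
    have "(v has_vector_derivative
        (cos (\<omega> * x) *\<^sub>R (\<omega> *\<^sub>R quarter_turn (u x)) + (- \<omega> * sin (\<omega> * x)) *\<^sub>R u x)
        - (sin (\<omega> * x) *\<^sub>R quarter_turn (\<omega> *\<^sub>R quarter_turn (u x)) + (\<omega> * cos (\<omega> * x)) *\<^sub>R quarter_turn (u x))) (at x)"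
      unfolding v_def[abs_def]
      by (intro has_vector_derivative_diff has_vector_derivative_scaleR c u'\<omega>[OF x]
          bounded_linear.has_vector_derivative[OF bounded_linear_quarter_turn])
    then show "(v has_vector_derivative 0) (at x)"
      by (simp add: quarter_turn_scaleR mult.commute)
  qed
  also have "v 0 = u0" by (simp add: v_def u_0)
  finally have v: "v t = u0" .
  have "plane (v t) (cis (\<omega> * t)) =
      (cos (\<omega> * t) * cos (\<omega> * t) + sin (\<omega> * t) * sin (\<omega> * t)) *\<^sub>R u t"
    by (simp add: plane_def v_def quarter_turn_diff quarter_turn_scaleR algebra_simps
        del: sin_cos_squared_add3)
  also have "\<dots> = u t"
    by simp
  finally have "plane (v t) (cis (\<omega> * t)) = u t" .
  then show ?thesis by (simp add: v \<omega>_def)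
qed

text \<open>
  The stages do not move, so the direction vanishes and \<open>\<gamma> = 1\<close> by convention.
\<close>

lemma relaxed_step_exact_at_equilibrium:
  assumes G: "smooth_real G" and eq: "euclidean_hamiltonian_field G u0 = 0"
    and Y: "rk_stage_family UNIV s a (euclidean_hamiltonian_field G) u0 Y"
    and sol: "ode_solution UNIV (euclidean_hamiltonian_field G) u0 T u"
  shows "\<forall>\<^sub>F h in at_right 0. let d = rk_direction s b (euclidean_hamiltonian_field G) (Y h);
      \<gamma> = relaxation_param u0 h d in u0 + (\<gamma> * h) *\<^sub>R d - u (\<gamma> * h) = 0"
proof -
  let ?f = "euclidean_hamiltonian_field G"
  have "((\<lambda>u. (u \<bullet> u) / 2) has_derivative (\<lambda>v. (u0 \<bullet> v + v \<bullet> u0) / 2)) (at u0)"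
    by (auto intro!: derivative_eq_intros)
  then have "(\<lambda>u. (u \<bullet> u) / 2) differentiable (at u0)"
    unfolding differentiable_def by blast
  moreover have "deriv G differentiable (at x)" for x
    using spec[OF spec[OF assms(1)[unfolded smooth_real_def], of 1], of x] by simp
  ultimately have "deriv G \<circ> (\<lambda>u. (u \<bullet> u) / 2) differentiable (at u0)"
    by (intro differentiable_chain_at)
  then have "(\<lambda>u. deriv G ((u \<bullet> u) / 2)) differentiable (at u0)"
    by (simp add: o_def)
  moreover have "quarter_turn differentiable (at u0)"
    by (rule bounded_linear_imp_differentiable) (rule bounded_linear_quarter_turn)
  ultimately have "?f differentiable (at u0)"
    unfolding euclidean_hamiltonian_field_quarter_turn[abs_def] power2_norm_eq_inner
    by (rule differentiable_scaleR)
  then obtain f' where "(?f has_derivative f') (at u0)" by (auto simp: differentiable_def)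
  from rk_stages_at_equilibrium[OF this eq Y]
  have "\<forall>\<^sub>F h in at_right 0. rk_direction s b ?f (Y h) = 0"
    by eventually_elim (simp add: rk_direction_def eq)
  moreover have "\<forall>\<^sub>F h in at_right 0. u h = u0"
  proof -
    have "T > 0" using sol by (simp add: ode_solution_def)
    then have "\<forall>\<^sub>F h in at_right 0. h > 0 \<and> h < T"
      by (auto simp: eventually_at_right[of 0 1] intro!: exI[of _ T])
    then show ?thesis
    proof eventually_elim
      case (elim h)
      have "plane u0 (cis (deriv G ((norm u0)\<^sup>2 / 2) * h)) = u0"
        using eq by (cases "u0 = 0")
          (auto simp: euclidean_hamiltonian_field_quarter_turn
            simp flip: norm_eq_zero[of "quarter_turn u0"])
      then show ?case using hamiltonian_solution_rotation[OF sol, of h] elim by simp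
    qed
  qed
  ultimately show ?thesis
    by eventually_elim (simp add: relaxation_param_def is_relaxation_def)
qed

theorem theorem4p1:
  fixes G :: "real \<Rightarrow> real"
    and f :: "(real ^ 'k) \<times> (real ^ 'k) \<Rightarrow> (real ^ 'k) \<times> (real ^ 'k)"
    and s p :: nat and a :: "nat \<Rightarrow> nat \<Rightarrow> real" and b :: "nat \<Rightarrow> real"
  assumes "smooth_real G"
    and "f = euclidean_hamiltonian_field G"
    and "rk_has_order s a b p"
    and "\<And>u0 Y. rk_stage_family UNIV s a f u0 Y \<Longrightarrow>
           \<forall>\<^sub>F h in at_right 0. \<exists>\<gamma>. is_relaxation u0 h (rk_direction s b f (Y h)) \<gamma>"
    and "odd p"
  shows "rrk_has_order s a b f (p + 1)"
  unfolding rrk_has_order_def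
proof (intro allI impI)
  fix u0 Y T u
  assume Y: "rk_stage_family UNIV s a f u0 Y" and sol: "ode_solution UNIV f u0 T u"
  define \<gamma> where "\<gamma> h = relaxation_param u0 h (rk_direction s b f (Y h))" for h
  have "(\<lambda>h. norm (u0 + (\<gamma> h * h) *\<^sub>R rk_direction s b f (Y h) - u (\<gamma> h * h)))
      \<in> O[at_right 0](\<lambda>h. h ^ (p + 1 + 1))"
  proof (cases "f u0 = 0")
    case True
    have "\<forall>\<^sub>F h in at_right 0.
        norm (u0 + (\<gamma> h * h) *\<^sub>R rk_direction s b f (Y h) - u (\<gamma> h * h)) = 0"
      using relaxed_step_exact_at_equilibrium[OF assms(1), of u0 s a Y T u b] True Y sol
      by (simp add: assms(2) \<gamma>_def Let_def)
    then show ?thesis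
      by (rule landau_o.big.in_cong[THEN iffD2, OF _ zero_in_bigo])
  next
    case False
    define \<kappa> where "\<kappa> = (\<lambda>x. deriv G ((norm u0)\<^sup>2 / 2 * x))"
    define \<omega> where "\<omega> = \<kappa> 1"
    define Z where "Z h i = coord u0 (Y h i)" for h i
    define d where "d h = rk_direction s b (rotation_field \<kappa>) (Z h)" for h
    have \<kappa>: "smooth_real \<kappa>"
      unfolding \<kappa>_def by (intro smooth_real_scale smooth_real_deriv assms(1))
    have u0: "u0 \<noteq> 0" and \<omega>: "\<omega> \<noteq> 0"
      using False by (auto simp: assms(2) euclidean_hamiltonian_field_quarter_turn quarter_turn_zero \<omega>_def \<kappa>_def)
    have "isCont (deriv G) ((norm u0)\<^sup>2 / 2)"
      using smooth_real_isCont[OF assms(1), where m = 1] by simp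
    note plane = hamiltonian_stages_in_plane[OF this Y[unfolded assms(2)] u0]
    have Z: "rk_stage_family UNIV s a (rotation_field \<kappa>) 1 Z"
      using rk_stage_family_coord[OF Y[unfolded assms(2)] u0 plane] by (simp add: \<kappa>_def Z_def[abs_def])
    have dir: "\<forall>\<^sub>F h in at_right 0. rk_direction s b f (Y h) = plane u0 (d h)"
      using plane
    proof eventually_elim
      case (elim h)
      have "f (Y h i) = plane u0 (rotation_field \<kappa> (Z h i))" if "i \<in> {1..s}" for i
        using elim that euclidean_hamiltonian_field_plane[of G u0]
        unfolding assms(2) Z_def \<kappa>_def by metis
      then show ?case
        by (simp add: rk_direction_def d_def linear_sum[OF plane_linear] linear_scale[OF plane_linear])
    qed
    have err: "(\<lambda>h. cmod (1 + h *\<^sub>R d h - cis (\<omega> * h))) \<in> O[at_right 0](\<lambda>h. h ^ (p + 1))"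
      unfolding d_def \<omega>_def by (rule rk_order_rotation[OF assms(3) \<kappa> Z])
    obtain m where m: "p = 2 * m + 1" using assms(5) by (rule oddE)
    have phase: "(\<lambda>h. h * Im (d h) - sin (\<omega> * h)) \<in> O[at_right 0](\<lambda>h. h ^ (p + 2))"
    proof -
      \<comment> \<open>The phase error divided by \<open>h\<close>, which turns the odd function into an even one.\<close>
      define \<phi> where "\<phi> h = Im (d h) + - 1 * (sin (\<omega> * h) / h)" for h
      have h\<phi>: "\<forall>\<^sub>F h in at_right 0. h * Im (d h) - sin (\<omega> * h) = h * \<phi> h"
        using eventually_at_right_less[of "0::real"]
        by eventually_elim (simp add: \<phi>_def right_diff_distrib)
      have "even_expansion (m + 1) \<phi>"
        unfolding \<phi>_def d_def
        by (intro even_expansion_add even_expansion_mult even_expansion_const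
            even_expansion_sin_div Im_direction_even_expansion[OF \<kappa> Z])
      moreover have "(\<lambda>h. h * Im (d h) - sin (\<omega> * h)) \<in> O[at_right 0](\<lambda>h. h ^ Suc p)"
      proof (rule landau_o.big_trans, rule bigoI[of _ 1], rule always_eventually, rule allI)
        fix h
        show "norm (h * Im (d h) - sin (\<omega> * h)) \<le> 1 * norm (cmod (1 + h *\<^sub>R d h - cis (\<omega> * h)))"
          using abs_Im_le_cmod[of "1 + h *\<^sub>R d h - cis (\<omega> * h)"] by simp
      qed (use err in simp)
      then have "(\<lambda>h. h * \<phi> h) \<in> O[at_right 0](\<lambda>h. h ^ Suc p)"
        using landau_o.big.in_cong[OF h\<phi>] by blast
      then have "\<phi> \<in> O[at_right 0](\<lambda>h. h ^ p)" by (rule bigo_cancel_h)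
      ultimately have "\<phi> \<in> O[at_right 0](\<lambda>h. h ^ (p + 1))"
        using even_expansion_bigo_odd_imp_even[of m \<phi>] by (simp add: m)
      then have "(\<lambda>h. h * \<phi> h) \<in> O[at_right 0](\<lambda>h. h ^ (1 + (p + 1)))"
        by (intro bigo_mult_power) auto
      then have "(\<lambda>h. h * \<phi> h) \<in> O[at_right 0](\<lambda>h. h ^ (p + 2))" by simp
      then show ?thesis using landau_o.big.in_cong[OF h\<phi>] by blast
    qed
    have plane_step: "u0 + c *\<^sub>R plane u0 z = plane u0 (1 + c *\<^sub>R z)" for c z
      by (simp add: linear_add[OF plane_linear] linear_scale[OF plane_linear])
    have relax: "\<forall>\<^sub>F h in at_right 0. d h \<noteq> 0 \<longrightarrow> \<gamma> h \<noteq> 0 \<and> cmod (1 + (\<gamma> h * h) *\<^sub>R d h) = 1"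
      using assms(4)[OF Y] dir eventually_at_right_less[of "0::real"]
    proof (eventually_elim, intro impI)
      fix h assume h: "\<exists>\<gamma>. is_relaxation u0 h (rk_direction s b f (Y h)) \<gamma>" "0 < h" "d h \<noteq> 0"
        and dir: "rk_direction s b f (Y h) = plane u0 (d h)"
      have "is_relaxation u0 h (plane u0 (d h)) (\<gamma> h)"
        using is_relaxation_relaxation_param[of h u0 "plane u0 (d h)"] h by (simp add: \<gamma>_def dir)
      then have "\<gamma> h \<noteq> 0" "(norm (plane u0 (1 + (\<gamma> h * h) *\<^sub>R d h)))\<^sup>2 = (norm u0)\<^sup>2"
        using h(3) by (simp_all add: is_relaxation_def plane_eq_zero_iff[OF u0] plane_step)
      moreover from this(2) have "norm (plane u0 (1 + (\<gamma> h * h) *\<^sub>R d h)) = norm u0"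
        by (rule power2_eq_imp_eq) auto
      ultimately show "\<gamma> h \<noteq> 0 \<and> cmod (1 + (\<gamma> h * h) *\<^sub>R d h) = 1"
        using u0 by (simp add: norm_plane)
    qed
    have p1: "p \<ge> 1" using m by simp
    have T: "T > 0" using sol by (simp add: ode_solution_def)
    have "\<forall>\<^sub>F h in at_right 0. \<bar>\<gamma> h * h\<bar> < T"
      using tendstoD[OF relaxed_error_on_circle(1)[OF p1 \<omega> err phase relax] T] by simp
    with dir have "\<forall>\<^sub>F h in at_right 0.
        norm (norm (u0 + (\<gamma> h * h) *\<^sub>R rk_direction s b f (Y h) - u (\<gamma> h * h))) \<le>
        norm u0 * norm (cmod (1 + (\<gamma> h * h) *\<^sub>R d h - cis (\<omega> * (\<gamma> h * h))))"
    proof eventually_elim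
      case (elim h)
      have "u (\<gamma> h * h) = plane u0 (cis (\<omega> * (\<gamma> h * h)))"
        using hamiltonian_solution_rotation[OF sol[unfolded assms(2)] elim(2)]
        by (simp add: \<omega>_def \<kappa>_def)
      then have "u0 + (\<gamma> h * h) *\<^sub>R rk_direction s b f (Y h) - u (\<gamma> h * h) =
          plane u0 (1 + (\<gamma> h * h) *\<^sub>R d h - cis (\<omega> * (\<gamma> h * h)))"
        by (simp add: elim(1) plane_step linear_diff[OF plane_linear])
      then show ?case by (simp add: norm_plane mult.commute)
    qed
    then have "(\<lambda>h. norm (u0 + (\<gamma> h * h) *\<^sub>R rk_direction s b f (Y h) - u (\<gamma> h * h))) \<in>
        O[at_right 0](\<lambda>h. cmod (1 + (\<gamma> h * h) *\<^sub>R d h - cis (\<omega> * (\<gamma> h * h))))"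
      by (rule bigoI)
    from landau_o.big_trans[OF this relaxed_error_on_circle(2)[OF p1 \<omega> err phase relax]]
    show ?thesis by simp
  qed
  then show "(\<lambda>h. let d = rk_direction s b f (Y h); \<gamma> = relaxation_param u0 h d
      in norm (u0 + (\<gamma> * h) *\<^sub>R d - u (\<gamma> * h))) \<in> O[at_right 0](\<lambda>h. h ^ (p + 1 + 1))"
    by (simp only: \<gamma>_def Let_def)
qed

end
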